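(* Consider an initial value problem with state $x\in\mathbb{R}^n$, $x(0)=x_0$, $\dot x=f(x)$, $t\in[0,T]$, $x_0\sim\mathcal{N}(\mu,\Sigma)$, where $f$ is piecewise affine with affine switching function, $$f(x)=\begin{cases}A_1x+\bar f_1, & g^\top(x-\bar x)<0,\\ A_2x+\bar f_2, & g^\top(x-\bar x)>0,\end{cases}$$ with $A_1,A_2\in\mathbb{R}^{n\times n}$, $\bar f_1,\bar f_2,g,\bar x\in\mathbb{R}^n$, $g\neq 0$, and write $f_i(x)=A_ix+\bar f_i$ for $i=1,2$. Then the right-hand side of the normal-approximation initial value problem in $\mu$ and $\Sigma$, $$\dot\mu=\hat f_\mu(\mu,\Sigma):=\mathbb{E}_{x\sim\mathcal{N}(\mu,\Sigma)}\{f(x)\},\qquad \dot\Sigma=\hat f_\Sigma(\mu,\Sigma):=\mathbb{E}_{x\sim\mathcal{N}(\mu,\Sigma)}\{f(x)(x-\mu)^\top\}+\mathbb{E}_{x\sim\mathcal{N}(\mu,\Sigma)}\{f(x)(x-\mu)^\top\}^\top,$$ can be stated explicitly as $$\dot\mu=\hat f_\mu(\mu,\Sigma),\qquad \dot\Sigma=\frac{\partial\hat f_\mu(\mu,\Sigma)}{\partial\mu}\Sigma+\Sigma\frac{\partial\hat f_\mu(\mu,\Sigma)}{\partial\mu}^\top=\hat f_\Sigma(\mu,\Sigma),$$ with $$\hat f_\mu(\mu,\Sigma)=(A_2-A_1)\Sigma g\,\tilde\phi_g(\bar x_g;\mu,\Sigma)+f_1(\mu)\,\tilde\Phi_g(\bar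 x_g;\mu,\Sigma)+f_2(\mu)\bigl(1-\tilde\Phi_g(\bar x_g;\mu,\Sigma)\bigr)$$ and $\hat f_\Sigma(\mu,\Sigma)=M+M^\top$, where $$M=(A_2-A_1)\frac{\Sigma gg^\top\Sigma}{g^\top\Sigma g}(\bar x_g-g^\top\mu)\,\tilde\phi_g(\bar x_g;\mu,\Sigma)+(f_2(\mu)-f_1(\mu))g^\top\Sigma\,\tilde\phi_g(\bar x_g;\mu,\Sigma)+A_1\Sigma\,\tilde\Phi_g(\bar x_g;\mu,\Sigma)+A_2\Sigma\bigl(1-\tilde\Phi_g(\bar x_g;\mu,\Sigma)\bigr).$$
   Context: $\mathcal{N}(\mu,\Sigma)$ is the normal distribution on $\mathbb{R}^n$ with mean $\mu\in\mathbb{R}^n$ and symmetric positive definite covariance $\Sigma\in\mathbb{R}^{n\times n}$. The value of $f$ on the hyperplane $g^\top(x-\bar x)=0$ (a Lebesgue null set) is irrelevant for the expectations. The initial value problem in $(\mu,\Sigma)$ serves to define an approximation $\mathcal{N}(\mu(t),\Sigma(t))$ of the exact state distribution at time $t$; the proposition concerns the closed-form expressions of its right-hand side. Let $\phi(\nu)=\frac{1}{\sqrt{2\pi}}e^{-\nu^2/2}$ and $\Phi(\nu)=\int_{-\infty}^{\nu}\phi(\nu')\,\mathrm{d}\nu'$ be the density and CDF of the univariate standard normal distribution. For $\xi\in\mathbb{R}$, $$\tilde\phi_g(\xi;\mu,\Sigma)=\frac{1}{\sqrt{g^\top\Sigma g}}\,\phi\!\left(\frac{\xi-g^\top\mu}{\sqrt{g^\top\Sigma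 g}}\right),\qquad \tilde\Phi_g(\xi;\mu,\Sigma)=\Phi\!\left(\frac{\xi-g^\top\mu}{\sqrt{g^\top\Sigma g}}\right)$$ are the density and CDF of the projection of $\mathcal{N}(\mu,\Sigma)$ onto the direction $g$, and $\bar x_g=g^\top\bar x$. $\frac{\partial\hat f_\mu}{\partial\mu}$ denotes the $n\times n$ Jacobian with respect to $\mu$. *)

theory Defs
  imports "HOL-Probability.Probability"
begin

definition spd :: "real^'n^'n \<Rightarrow> bool" where
  "spd S \<longleftrightarrow> transpose S = S \<and> (\<forall>x. x \<noteq> 0 \<longrightarrow> x \<bullet> (S *v x) > 0)"

text \<open>The product \<open>u v\<^sup>T\<close> of a column by a row.\<close>

definition outer_prod :: "real^'n \<Rightarrow> real^'n \<Rightarrow> real^'n^'n" where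
  "outer_prod u v = (\<chi> i j. u $ i * v $ j)"

definition mv_normal_density :: "real^'n \<Rightarrow> real^'n^'n \<Rightarrow> real^'n \<Rightarrow> real" where
  "mv_normal_density \<mu> \<Sigma> x =
     exp (- ((x - \<mu>) \<bullet> (matrix_inv \<Sigma> *v (x - \<mu>))) / 2) / sqrt ((2 * pi) ^ CARD('n) * det \<Sigma>)"

text \<open>The base measure is the completion of the Borel-Lebesgue measure. So a function whose
  values on a null set are arbitrary, possibly making it non-Borel, still has the expectation
  determined by its values elsewhere. The measure is only meaningful for \<open>spd \<Sigma>\<close>.\<close>

definition mv_normal :: "real^'n \<Rightarrow> real^'n^'n \<Rightarrow> (real^'n) measure" where
  "mv_normal \<mu> \<Sigma> = density lebesgue (\<lambda>x. ennreal (mv_normal_density \<mu> \<Sigma> x))"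

definition mean_rhs :: "(real^'n \<Rightarrow> real^'n) \<Rightarrow> real^'n \<Rightarrow> real^'n^'n \<Rightarrow> real^'n" where
  "mean_rhs f \<mu> \<Sigma> = (LINT x|mv_normal \<mu> \<Sigma>. f x)"

definition cov_rhs :: "(real^'n \<Rightarrow> real^'n) \<Rightarrow> real^'n \<Rightarrow> real^'n^'n \<Rightarrow> real^'n^'n" where
  "cov_rhs f \<mu> \<Sigma> =
     (LINT x|mv_normal \<mu> \<Sigma>. outer_prod (f x) (x - \<mu>)) +
     transpose (LINT x|mv_normal \<mu> \<Sigma>. outer_prod (f x) (x - \<mu>))"

text \<open>A solution must stay in the domain of the right-hand side, i.e. where the covariance is
  symmetric positive definite. At the end points of \<open>[0, T]\<close> derivatives are one-sided.\<close>

definition solves_moment_ivp ::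
  "(real^'n \<Rightarrow> real^'n^'n \<Rightarrow> real^'n) \<Rightarrow> (real^'n \<Rightarrow> real^'n^'n \<Rightarrow> real^'n^'n) \<Rightarrow> real \<Rightarrow>
   real^'n \<Rightarrow> real^'n^'n \<Rightarrow> (real \<Rightarrow> real^'n) \<Rightarrow> (real \<Rightarrow> real^'n^'n) \<Rightarrow> bool" where
  "solves_moment_ivp F G T \<mu>\<^sub>0 \<Sigma>\<^sub>0 m S \<longleftrightarrow>
     m 0 = \<mu>\<^sub>0 \<and> S 0 = \<Sigma>\<^sub>0 \<and>
     (\<forall>t\<in>{0..T}. spd (S t) \<and>
        (m has_vector_derivative F (m t) (S t)) (at t within {0..T}) \<and>
        (S has_vector_derivative G (m t) (S t)) (at t within {0..T}))"

definition std_normal_cdf :: "real \<Rightarrow> real" where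
  "std_normal_cdf \<nu> = (LINT s:{..\<nu>}|lborel. std_normal_density s)"

definition proj_density :: "real^'n \<Rightarrow> real \<Rightarrow> real^'n \<Rightarrow> real^'n^'n \<Rightarrow> real" where
  "proj_density g \<xi> \<mu> \<Sigma> =
     1 / sqrt (g \<bullet> (\<Sigma> *v g)) * std_normal_density ((\<xi> - g \<bullet> \<mu>) / sqrt (g \<bullet> (\<Sigma> *v g)))"

definition proj_cdf :: "real^'n \<Rightarrow> real \<Rightarrow> real^'n \<Rightarrow> real^'n^'n \<Rightarrow> real" where
  "proj_cdf g \<xi> \<mu> \<Sigma> = std_normal_cdf ((\<xi> - g \<bullet> \<mu>) / sqrt (g \<bullet> (\<Sigma> *v g)))"

definition pwa_mean ::
  "real^'n^'n \<Rightarrow> real^'n \<Rightarrow> real^'n^'n \<Rightarrow> real^'n \<Rightarrow> real^'n \<Rightarrow> real^'n \<Rightarrow> real^'n \<Rightarrow> real^'n^'n \<Rightarrow> real^'n"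
where
  "pwa_mean A\<^sub>1 b\<^sub>1 A\<^sub>2 b\<^sub>2 g xbar \<mu> \<Sigma> =
     proj_density g (g \<bullet> xbar) \<mu> \<Sigma> *\<^sub>R ((A\<^sub>2 - A\<^sub>1) *v (\<Sigma> *v g)) +
     proj_cdf g (g \<bullet> xbar) \<mu> \<Sigma> *\<^sub>R (A\<^sub>1 *v \<mu> + b\<^sub>1) +
     (1 - proj_cdf g (g \<bullet> xbar) \<mu> \<Sigma>) *\<^sub>R (A\<^sub>2 *v \<mu> + b\<^sub>2)"

definition pwa_cov_half ::
  "real^'n^'n \<Rightarrow> real^'n \<Rightarrow> real^'n^'n \<Rightarrow> real^'n \<Rightarrow> real^'n \<Rightarrow> real^'n \<Rightarrow> real^'n \<Rightarrow> real^'n^'n \<Rightarrow> real^'n^'n"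
where
  "pwa_cov_half A\<^sub>1 b\<^sub>1 A\<^sub>2 b\<^sub>2 g xbar \<mu> \<Sigma> =
     ((g \<bullet> xbar - g \<bullet> \<mu>) * proj_density g (g \<bullet> xbar) \<mu> \<Sigma>) *\<^sub>R
       ((A\<^sub>2 - A\<^sub>1) ** ((1 / (g \<bullet> (\<Sigma> *v g))) *\<^sub>R (\<Sigma> ** outer_prod g g ** \<Sigma>))) +
     proj_density g (g \<bullet> xbar) \<mu> \<Sigma> *\<^sub>R
       (outer_prod ((A\<^sub>2 *v \<mu> + b\<^sub>2) - (A\<^sub>1 *v \<mu> + b\<^sub>1)) g ** \<Sigma>) +
     proj_cdf g (g \<bullet> xbar) \<mu> \<Sigma> *\<^sub>R (A\<^sub>1 ** \<Sigma>) +
     (1 - proj_cdf g (g \<bullet> xbar) \<mu> \<Sigma>) *\<^sub>R (A\<^sub>2 ** \<Sigma>)"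

definition pwa_cov ::
  "real^'n^'n \<Rightarrow> real^'n \<Rightarrow> real^'n^'n \<Rightarrow> real^'n \<Rightarrow> real^'n \<Rightarrow> real^'n \<Rightarrow> real^'n \<Rightarrow> real^'n^'n \<Rightarrow> real^'n^'n"
where
  "pwa_cov A\<^sub>1 b\<^sub>1 A\<^sub>2 b\<^sub>2 g xbar \<mu> \<Sigma> =
     pwa_cov_half A\<^sub>1 b\<^sub>1 A\<^sub>2 b\<^sub>2 g xbar \<mu> \<Sigma> + transpose (pwa_cov_half A\<^sub>1 b\<^sub>1 A\<^sub>2 b\<^sub>2 g xbar \<mu> \<Sigma>)"

text \<open>For \<open>F \<mu> \<Sigma>\<close> with Jacobian \<open>J\<close> in \<open>\<mu>\<close>: the matrix \<open>J \<Sigma> + \<Sigma> J\<^sup>T\<close>. The library's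
  Jacobian is only meaningful where \<open>F\<close> is differentiable in its first argument.\<close>

definition jacobian_cov ::
  "(real^'n \<Rightarrow> real^'n^'n \<Rightarrow> real^'n) \<Rightarrow> real^'n \<Rightarrow> real^'n^'n \<Rightarrow> real^'n^'n" where
  "jacobian_cov F \<mu> \<Sigma> =
     jacobian (\<lambda>m. F m \<Sigma>) (at \<mu>) ** \<Sigma> + \<Sigma> ** transpose (jacobian (\<lambda>m. F m \<Sigma>) (at \<mu>))"

end

theory Submission
  imports Defs "HOL-Real_Asymp.Real_Asymp"
begin

text \<open>
  Put \<open>\<sigma> = sqrt (g\<^sup>T \<Sigma> g)\<close> and choose \<open>W\<close> with \<open>W\<^sup>T \<Sigma> W = 1\<close> whose \<open>k\<close>-th column is
  \<open>g / \<sigma>\<close>. The substitution \<open>x = \<mu> + \<Sigma> W z\<close> turns \<open>N(\<mu>, \<Sigma>)\<close> into a product of standard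
  normals, and \<open>g\<^sup>T (x - \<mu>) = \<sigma> z\<^sub>k\<close>, so the switching surface becomes \<open>z\<^sub>k = c\<close> for a constant
  \<open>c\<close>. All expectations of \<open>f\<close> are then combinations of the truncated moments of orders 0, 1, 2 of
  the single coordinate \<open>z\<^sub>k\<close>, which are \<open>\<Phi>(c)\<close>, \<open>- \<phi>(c)\<close> and \<open>\<Phi>(c) - c \<phi>(c)\<close>. Differentiating
  the resulting closed form of the mean in \<open>\<mu>\<close> gives a Jacobian \<open>J\<close> for which \<open>J \<Sigma>\<close> is the
  closed form of the expectation of \<open>f(x) (x - \<mu>)\<^sup>T\<close>.
\<close>

subsection \<open>Affine change of variables for Lebesgue measure\<close>

lemma sum_Basis_cart:
  fixes h :: "real^'n \<Rightarrow> 'b::comm_monoid_add"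
  shows "(\<Sum>b\<in>Basis. h b) = (\<Sum>i\<in>UNIV. h (axis i 1))"
proof -
  have eq: "(Basis :: (real^'n) set) = (\<lambda>i. axis i 1) ` UNIV"
    by (auto simp: Basis_vec_def)
  have "inj (\<lambda>i::'n. axis i (1::real))"
    by (auto simp: inj_on_def axis_eq_axis)
  then show ?thesis
    unfolding eq by (simp add: sum.reindex)
qed

lemma prod_Basis_cart:
  fixes h :: "real^'n \<Rightarrow> 'b::comm_monoid_mult"
  shows "(\<Prod>b\<in>Basis. h b) = (\<Prod>i\<in>UNIV. h (axis i 1))"
proof -
  have eq: "(Basis :: (real^'n) set) = (\<lambda>i. axis i 1) ` UNIV"
    by (auto simp: Basis_vec_def)
  have "inj (\<lambda>i::'n. axis i (1::real))"
    by (auto simp: inj_on_def axis_eq_axis)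
  then show ?thesis
    unfolding eq by (simp add: prod.reindex)
qed

lemma emeasure_lborel_box_cart:
  fixes l u :: "real^'n"
  assumes "\<And>i. l $ i \<le> u $ i"
  shows "emeasure lborel (box l u) = ennreal (\<Prod>i\<in>UNIV. u $ i - l $ i)"
proof -
  have "l \<bullet> b \<le> u \<bullet> b" if "b \<in> Basis" for b
    using that assms by (auto simp: Basis_vec_def inner_axis)
  then show ?thesis
    by (subst emeasure_lborel_box) (simp_all add: prod_Basis_cart inner_axis)
qed

lemma lborel_cart_eqI:
  fixes M :: "(real^'n) measure"
  assumes "\<And>l u. (\<And>i. l $ i \<le> u $ i) \<Longrightarrow> emeasure M (box l u) = (\<Prod>i\<in>UNIV. u $ i - l $ i)"
    and "sets M = sets borel"
  shows "lborel = M"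
proof (rule lborel_eqI)
  fix l u :: "real^'n"
  assume "\<And>b. b \<in> Basis \<Longrightarrow> l \<bullet> b \<le> u \<bullet> b"
  then have "l $ i \<le> u $ i" for i
    by (metis axis_in_Basis_iff Basis_real_def inner_axis inner_real_def mult.right_neutral singletonI)
  then show "emeasure M (box l u) = (\<Prod>b\<in>Basis. (u - l) \<bullet> b)"
    using assms(1) by (simp add: prod_Basis_cart inner_axis)
qed fact

lemma measurable_vec_lambda_PiM [measurable]:
  "(\<lambda>x. \<chi> i. x i) \<in> (\<Pi>\<^sub>M i\<in>(UNIV::'n::finite set). (lborel::real measure)) \<rightarrow>\<^sub>M borel"
proof (subst borel_measurable_euclidean_space, safe)
  fix b :: "real^'n" assume "b \<in> Basis"
  then obtain i where b: "b = axis i 1" by (auto simp: Basis_vec_def)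
  show "(\<lambda>x. (\<chi> i. x i) \<bullet> b) \<in> borel_measurable (\<Pi>\<^sub>M i\<in>UNIV. lborel)"
    unfolding b by (simp add: inner_axis) measurable
qed

lemma borel_measurable_matrix_vector [measurable (raw)]:
  fixes f :: "'a \<Rightarrow> real^'n" and A :: "real^'n^'m"
  assumes "f \<in> borel_measurable M"
  shows "(\<lambda>x. A *v f x) \<in> borel_measurable M"
  by (rule borel_measurable_continuous_on[OF _ assms])
    (intro linear_continuous_on matrix_vector_mul_bounded_linear)

text \<open>Identifies Lebesgue measure on vectors with a product measure, so that Fubini can be
  applied coordinate by coordinate, both to shears and to products of one-dimensional
  integrands.\<close>

lemma lborel_cart_eq:
  "(lborel :: (real^'n) measure) = distr (\<Pi>\<^sub>M i\<in>UNIV. lborel) borel (\<lambda>x. \<chi> i. x i)"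
proof (rule lborel_cart_eqI)
  interpret product_sigma_finite "\<lambda>_::'n. lborel :: real measure" ..
  fix l u :: "real^'n" assume le: "\<And>i. l $ i \<le> u $ i"
  have "(\<lambda>x. \<chi> i. x i) -` box l u = (\<Pi>\<^sub>E i\<in>UNIV. {l $ i <..< u $ i})"
    by (auto simp: mem_box_cart PiE_def Pi_iff)
  then have "emeasure (distr (\<Pi>\<^sub>M i\<in>UNIV. lborel) borel (\<lambda>x. \<chi> i. x i)) (box l u)
      = emeasure (\<Pi>\<^sub>M i\<in>UNIV. lborel) (\<Pi>\<^sub>E i\<in>UNIV. {l $ i <..< u $ i})"
    by (subst emeasure_distr) (auto simp: space_PiM)
  also have "\<dots> = (\<Prod>i\<in>UNIV. ennreal (u $ i - l $ i))"
    using le by (subst emeasure_PiM) auto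
  also have "\<dots> = ennreal (\<Prod>i\<in>UNIV. u $ i - l $ i)"
    using le by (intro prod_ennreal) auto
  finally show "emeasure (distr (\<Pi>\<^sub>M i\<in>UNIV. lborel) borel (\<lambda>x. \<chi> i. x i)) (box l u)
      = (\<Prod>i\<in>UNIV. u $ i - l $ i)" .
qed simp

text \<open>The change-of-variables theorems of the library require a well-ordered index type, so the
  linear case is derived here for an arbitrary finite one, by factoring into elementary matrices.\<close>

definition scales_lborel :: "real^'n^'n \<Rightarrow> bool" where
  "scales_lborel A \<longleftrightarrow> (\<forall>h \<in> borel_measurable borel.
     (\<integral>\<^sup>+x. ennreal \<bar>det A\<bar> * h (A *v x) \<partial>lborel) = (\<integral>\<^sup>+x. h x \<partial>lborel))"

lemma scales_lborelD:
  assumes "scales_lborel A" and "h \<in> borel_measurable borel"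
  shows "(\<integral>\<^sup>+x. ennreal \<bar>det A\<bar> * h (A *v x) \<partial>lborel) = (\<integral>\<^sup>+x. h x \<partial>lborel)"
  using assms by (auto simp: scales_lborel_def)

text \<open>Testing against all non-negative Borel functions makes composition immediate: the
  identity for \<open>B\<close> is applied to the function sending \<open>x\<close> to |det A| h(A
  x), then the one for \<open>A\<close> to \<open>h\<close>.\<close>

lemma scales_lborel_mult:
  fixes A B :: "real^'n^'n"
  assumes A: "scales_lborel A" and B: "scales_lborel B"
  shows "scales_lborel (A ** B)"
  unfolding scales_lborel_def
proof
  fix h :: "real^'n \<Rightarrow> ennreal" assume h [measurable]: "h \<in> borel_measurable borel"
  have "(\<integral>\<^sup>+x. ennreal \<bar>det B\<bar> * (ennreal \<bar>det A\<bar> * h (A *v (B *v x))) \<partial>lborel)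
      = (\<integral>\<^sup>+x. ennreal \<bar>det A\<bar> * h (A *v x) \<partial>lborel)"
    by (rule scales_lborelD[OF B]) measurable
  also have "\<dots> = (\<integral>\<^sup>+x. h x \<partial>lborel)"
    using A h by (rule scales_lborelD)
  finally show "(\<integral>\<^sup>+x. ennreal \<bar>det (A ** B)\<bar> * h ((A ** B) *v x) \<partial>lborel) = (\<integral>\<^sup>+x. h x \<partial>lborel)"
    by (simp add: det_mul abs_mult ennreal_mult mult_ac matrix_vector_mul_assoc)
qed

lemma scales_lborel_diagonal:
  fixes A :: "real^'n^'n"
  assumes diag: "\<And>i j. i \<noteq> j \<Longrightarrow> A $ i $ j = 0" and det: "det A \<noteq> 0"
  shows "scales_lborel A"
  unfolding scales_lborel_def
proof
  fix h :: "real^'n \<Rightarrow> ennreal" assume h [measurable]: "h \<in> borel_measurable borel"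
  define c where "c b = b \<bullet> (A *v b)" for b :: "real^'n"
  have cA: "c (axis i 1) = A $ i $ i" for i
    by (simp add: c_def inner_axis' matrix_vector_mult_basis column_def)
  have detA: "det A = (\<Prod>i\<in>UNIV. A $ i $ i)"
    using diag by (rule det_diagonal)
  have c: "c b \<noteq> 0" if "b \<in> Basis" for b
    using that det by (auto simp: Basis_vec_def cA detA)
  \<comment> \<open>The left side is the map of \<open>lborel_affine_euclidean\<close> with offset
    0; for a diagonal matrix it is multiplication by that matrix.\<close>
  have T: "0 + (\<Sum>j\<in>Basis. (c j * (x \<bullet> j)) *\<^sub>R j) = A *v x" for x
  proof -
    have "(A *v x) $ i = A $ i $ i * x $ i" for i
      using diag by (simp add: matrix_vector_mult_def sum.remove[of UNIV i])
    moreover have "r * axis j 1 $ i = (if j = i then r else 0)" for i j :: 'n and r :: real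
      by (simp add: axis_def)
    ultimately show ?thesis
      by (simp add: sum_Basis_cart cA inner_axis vec_eq_iff)
  qed
  have "lborel = density (distr lborel borel (\<lambda>x. A *v x)) (\<lambda>_. ennreal \<bar>det A\<bar>)"
    using lborel_affine_euclidean[of c 0, OF c] unfolding T
    by (simp add: prod_Basis_cart cA detA abs_prod)
  then have "(\<integral>\<^sup>+x. h x \<partial>lborel)
      = (\<integral>\<^sup>+x. h x \<partial>density (distr lborel borel (\<lambda>x. A *v x)) (\<lambda>_. ennreal \<bar>det A\<bar>))"
    by simp
  then show "(\<integral>\<^sup>+x. ennreal \<bar>det A\<bar> * h (A *v x) \<partial>lborel) = (\<integral>\<^sup>+x. h x \<partial>lborel)"
    by (simp add: nn_integral_density nn_integral_distr)
qed

text \<open>Here \<open>Transposition.transpose\<close> exchanges two indices, so the matrix is the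
  identity with two columns swapped. Exchanging two coordinates sends boxes to boxes with the same
  side lengths, and boxes determine \<open>lborel\<close>.\<close>

lemma scales_lborel_swap:
  fixes m n :: "'n::finite"
  shows "scales_lborel (\<chi> i j. mat 1 $ i $ Transposition.transpose m n j :: real^'n^'n)"
    (is "scales_lborel ?A")
  unfolding scales_lborel_def
proof
  let ?p = "Transposition.transpose m n"
  fix h :: "real^'n \<Rightarrow> ennreal" assume h [measurable]: "h \<in> borel_measurable borel"
  have p: "?p permutes UNIV" by (simp add: permutes_def) (metis transpose_involutory)
  have det: "\<bar>det ?A\<bar> = 1"
    using det_permute_columns[OF p, of "mat 1 :: real^'n^'n"] by (simp add: sign_def)
  have A: "(?A *v x) $ i = x $ ?p i" for x i
  proof -
    have "(i = ?p j) = (j = ?p i)" for j by (metis transpose_involutory)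
    then show ?thesis
      by (simp add: matrix_vector_mult_def mat_def if_distrib if_distribR cong: if_cong)
  qed
  have "lborel = distr lborel borel ((*v) ?A)"
  proof (rule lborel_cart_eqI)
    fix l u :: "real^'n" assume le: "\<And>i. l $ i \<le> u $ i"
    have "(*v) ?A -` box l u = box (?A *v l) (?A *v u)"
      by (auto simp: mem_box_cart A) (metis transpose_involutory)+
    then have "emeasure (distr lborel borel ((*v) ?A)) (box l u) = emeasure lborel (box (?A *v l) (?A *v u))"
      by (subst emeasure_distr) auto
    also have "\<dots> = ennreal (\<Prod>i\<in>UNIV. u $ ?p i - l $ ?p i)"
      using le by (subst emeasure_lborel_box_cart) (auto simp: A)
    also have "(\<Prod>i\<in>UNIV. u $ ?p i - l $ ?p i) = (\<Prod>i\<in>UNIV. u $ i - l $ i)"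
      using prod.permute[OF p, of "\<lambda>i. u $ i - l $ i"] by (simp add: o_def)
    finally show "emeasure (distr lborel borel ((*v) ?A)) (box l u) = (\<Prod>i\<in>UNIV. u $ i - l $ i)" .
  qed simp
  then have "(\<integral>\<^sup>+x. h x \<partial>lborel) = (\<integral>\<^sup>+x. h x \<partial>distr lborel borel ((*v) ?A))"
    by simp
  then show "(\<integral>\<^sup>+x. ennreal \<bar>det ?A\<bar> * h (?A *v x) \<partial>lborel) = (\<integral>\<^sup>+x. h x \<partial>lborel)"
    unfolding det by (simp add: nn_integral_distr)
qed

text \<open>The shear adds \<open>c\<close> times coordinate \<open>n\<close> to coordinate
  \<open>m\<close>. With coordinate \<open>m\<close> integrated innermost this is a translation by a
  constant, since \<open>m\<close> and \<open>n\<close> differ, and one-dimensional Lebesgue measure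
  is translation invariant.\<close>

lemma scales_lborel_shear:
  fixes m n :: "'n::finite"
  assumes mn: "m \<noteq> n"
  shows "scales_lborel (\<chi> i j. if i = m \<and> j = n then c else of_bool (i = j) :: real^'n^'n)"
    (is "scales_lborel ?A")
  unfolding scales_lborel_def
proof
  interpret product_sigma_finite "\<lambda>_::'n. lborel :: real measure" ..
  fix h :: "real^'n \<Rightarrow> ennreal" assume h [measurable]: "h \<in> borel_measurable borel"
  have "?A = (\<chi> k. if k = m then row m (mat 1) + c *s row n (mat 1) else row k (mat 1))"
    using mn by (auto simp: vec_eq_iff row_def mat_def)
  then have det: "\<bar>det ?A\<bar> = 1"
    using det_row_operation[OF mn, of "mat 1" c] by simp
  have A: "?A *v x = (\<chi> i. x $ i + (if i = m then c * x $ n else 0))" for x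
  proof -
    have "(\<Sum>j\<in>UNIV. (if i = m \<and> j = n then c else of_bool (i = j)) * x $ j)
      = (\<Sum>j\<in>UNIV. (if j = i then x $ j else 0) + (if j = n then if i = m then c * x $ j else 0 else 0))" for i
      using mn by (intro sum.cong) auto
    then show ?thesis
      by (simp add: vec_eq_iff matrix_vector_mult_def sum.distrib)
  qed
  let ?P = "\<lambda>I. \<Pi>\<^sub>M i\<in>I. lborel :: real measure" and ?J = "UNIV - {m}"
  have split: "(\<integral>\<^sup>+x. k x \<partial>lborel) = (\<integral>\<^sup>+x. (\<integral>\<^sup>+y. k (\<chi> i. (x(m := y)) i) \<partial>lborel) \<partial>?P ?J)"
    if [measurable]: "k \<in> borel_measurable borel" for k :: "real^'n \<Rightarrow> ennreal"
  proof -
    have U: "UNIV = insert m ?J" by auto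
    have "(\<integral>\<^sup>+x. k x \<partial>lborel) = (\<integral>\<^sup>+x. k (\<chi> i. x i) \<partial>?P UNIV)"
      by (subst lborel_cart_eq) (simp add: nn_integral_distr)
    also have "\<dots> = (\<integral>\<^sup>+x. k (\<chi> i. x i) \<partial>?P (insert m ?J))"
      using U by simp
    also have "\<dots> = (\<integral>\<^sup>+x. (\<integral>\<^sup>+y. k (\<chi> i. (x(m := y)) i) \<partial>lborel) \<partial>?P ?J)"
    proof (rule product_nn_integral_insert)
      show "(\<lambda>x. k (\<chi> i. x i)) \<in> borel_measurable (?P (insert m ?J))"
        unfolding U[symmetric] by measurable
    qed auto
    finally show ?thesis .
  qed
  have "(\<integral>\<^sup>+x. h (?A *v x) \<partial>lborel)
      = (\<integral>\<^sup>+x. (\<integral>\<^sup>+y. h (?A *v (\<chi> i. (x(m := y)) i)) \<partial>lborel) \<partial>?P ?J)"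
    by (rule split) measurable
  also have "\<dots> = (\<integral>\<^sup>+x. (\<integral>\<^sup>+y. h (\<chi> i. (x(m := y)) i) \<partial>lborel) \<partial>?P ?J)"
  proof (rule nn_integral_cong)
    fix x :: "'n \<Rightarrow> real"
    have [measurable]: "(\<lambda>y::real. \<chi> i. (x(m := y)) i) \<in> borel_measurable borel"
    proof (subst borel_measurable_euclidean_space, safe)
      fix b :: "real^'n" assume "b \<in> Basis"
      then obtain i where b: "b = axis i 1" by (auto simp: Basis_vec_def)
      show "(\<lambda>y. (\<chi> i. (x(m := y)) i) \<bullet> b) \<in> borel_measurable borel"
        unfolding b by (cases "i = m") (simp_all add: inner_axis)
    qed
    \<comment> \<open>The redundant factor 1 gives the argument the shape offset + scale * y
      expected by \<open>nn_integral_real_affine\<close>.\<close>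
    have "?A *v (\<chi> i. (x(m := y)) i) = (\<chi> i. (x(m := c * x n + 1 * y)) i)" for y
      using mn by (auto simp: A vec_eq_iff)
    then have "(\<integral>\<^sup>+y. h (?A *v (\<chi> i. (x(m := y)) i)) \<partial>lborel)
        = (\<integral>\<^sup>+y. h (\<chi> i. (x(m := c * x n + 1 * y)) i) \<partial>lborel)"
      by simp
    also have "\<dots> = (\<integral>\<^sup>+y. h (\<chi> i. (x(m := y)) i) \<partial>lborel)"
      by (subst (2) nn_integral_real_affine[of _ 1 "c * x n"]) (simp_all del: fun_upd_apply)
    finally show "(\<integral>\<^sup>+y. h (?A *v (\<chi> i. (x(m := y)) i)) \<partial>lborel)
        = (\<integral>\<^sup>+y. h (\<chi> i. (x(m := y)) i) \<partial>lborel)" .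
  qed
  also have "\<dots> = (\<integral>\<^sup>+x. h x \<partial>lborel)"
    by (rule split[symmetric]) measurable
  finally show "(\<integral>\<^sup>+x. ennreal \<bar>det ?A\<bar> * h (?A *v x) \<partial>lborel) = (\<integral>\<^sup>+x. h x \<partial>lborel)"
    unfolding det by simp
qed

lemma scales_lborel:
  fixes A :: "real^'n^'n"
  assumes "det A \<noteq> 0"
  shows "scales_lborel A"
proof -
  \<comment> \<open>The implication is what the induction over elementary factors carries: a zero
    row makes it vacuous, and a product with nonzero determinant has two nonsingular
    factors.\<close>
  have "det A \<noteq> 0 \<longrightarrow> scales_lborel A"
    by (rule induct_matrix_elementary)
      (auto simp: det_mul det_zero_row scales_lborel_mult scales_lborel_diagonal
         scales_lborel_swap scales_lborel_shear)
  with assms show ?thesis by blast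
qed

lemma lborel_eq_density_distr_affine:
  fixes A :: "real^'n^'n"
  assumes "det A \<noteq> 0"
  shows "lborel = density (distr lborel borel (\<lambda>x. t + A *v x)) (\<lambda>_. ennreal \<bar>det A\<bar>)"
    (is "_ = ?M")
proof (rule measure_eqI)
  fix B :: "(real^'n) set" assume "B \<in> sets lborel"
  then have B [measurable]: "B \<in> sets borel" by simp
  have "emeasure ?M B = (\<integral>\<^sup>+x. ennreal \<bar>det A\<bar> * indicator B (t + A *v x) \<partial>lborel)"
    by (simp add: emeasure_density nn_integral_distr)
  also have "\<dots> = (\<integral>\<^sup>+x. indicator B (t + x) \<partial>lborel)"
    by (rule scales_lborelD[OF scales_lborel[OF assms]]) measurable
  also have "\<dots> = (\<integral>\<^sup>+x. indicator B x \<partial>distr lborel borel ((+) t))"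
    by (subst nn_integral_distr) simp_all
  also have "\<dots> = emeasure lborel B"
    by (simp add: lborel_distr_plus)
  finally show "emeasure lborel B = emeasure ?M B" by simp
qed simp

text \<open>Goes from the transformed integrand back to the original one, so that integrability and
  value are obtained together.\<close>

lemma has_bochner_integral_lborel_affine:
  fixes A :: "real^'n^'n" and f :: "real^'n \<Rightarrow> 'b::{banach,second_countable_topology}"
  assumes det: "det A \<noteq> 0" and [measurable]: "f \<in> borel_measurable borel"
    and int: "has_bochner_integral lborel (\<lambda>x. \<bar>det A\<bar> *\<^sub>R f (t + A *v x)) I"
  shows "has_bochner_integral lborel f I"
proof (subst lborel_eq_density_distr_affine[OF det, of t], rule has_bochner_integral_density)
  have [measurable]: "(\<lambda>x. t + A *v x) \<in> lborel \<rightarrow>\<^sub>M borel" by measurable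
  show "has_bochner_integral (distr lborel borel (\<lambda>x. t + A *v x)) (\<lambda>x. \<bar>det A\<bar> *\<^sub>R f x) I"
    by (rule has_bochner_integral_distr) (simp_all add: int)
qed simp_all

subsection \<open>Truncated moments of the standard normal distribution\<close>

text \<open>A vector is the sum of its coordinates placed on the axes, which are bounded linear
  embeddings. The entries may themselves be vectors, so two applications reduce a matrix-valued
  integral to its scalar entries.\<close>

lemma has_bochner_integral_vecI:
  fixes f :: "'b \<Rightarrow> 'a::euclidean_space^'n"
  assumes "\<And>i. has_bochner_integral M (\<lambda>x. f x $ i) (v $ i)"
  shows "has_bochner_integral M f v"
proof -
  have lin: "bounded_linear (axis i :: 'a \<Rightarrow> 'a^'n)" for i
    unfolding linear_conv_bounded_linear[symmetric]
    by (intro linearI) (auto simp: vec_eq_iff axis_def)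
  have rep: "w = (\<Sum>i\<in>UNIV. axis i (w $ i))" for w :: "'a^'n"
    by (simp add: vec_eq_iff axis_def if_distrib cong: if_cong)
  have "has_bochner_integral M (\<lambda>x. \<Sum>i\<in>UNIV. axis i (f x $ i)) (\<Sum>i\<in>UNIV. axis i (v $ i))"
    by (intro has_bochner_integral_sum has_bochner_integral_bounded_linear[OF lin] assms)
  then show ?thesis by (simp flip: rep)
qed

lemma has_bochner_integral_lborel_prod:
  fixes f :: "'n::finite \<Rightarrow> real \<Rightarrow> real"
  assumes "\<And>i. has_bochner_integral lborel (f i) (c i)"
  shows "has_bochner_integral lborel (\<lambda>x::real^'n. \<Prod>i\<in>UNIV. f i (x $ i)) (\<Prod>i\<in>UNIV. c i)"
proof (subst lborel_cart_eq, rule has_bochner_integral_distr)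
  interpret product_sigma_finite "\<lambda>_::'n. lborel :: real measure" ..
  have int: "integrable lborel (f i)" for i
    using assms by (auto simp: has_bochner_integral_iff)
  then have [measurable]: "f i \<in> borel_measurable borel" for i
    using borel_measurable_integrable by fastforce
  show "(\<lambda>x::real^'n. \<Prod>i\<in>UNIV. f i (x $ i)) \<in> borel_measurable borel"
    by measurable
  have "integral\<^sup>L lborel (f i) = c i" for i
    using assms by (simp add: has_bochner_integral_iff)
  then show "has_bochner_integral (\<Pi>\<^sub>M i\<in>UNIV. lborel)
      (\<lambda>x. \<Prod>i\<in>UNIV. f i ((\<chi> i. x i) $ i)) (\<Prod>i\<in>UNIV. c i)"
    using product_integrable_prod[of UNIV f] product_integral_prod[of UNIV f] int
    by (simp add: has_bochner_integral_iff)
qed measurable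

lemma has_real_derivative_std_normal_density [derivative_intros]:
  assumes "(u has_real_derivative u') (at x within S)"
  shows "((\<lambda>x. std_normal_density (u x)) has_real_derivative - u x * std_normal_density (u x) * u')
    (at x within S)"
  unfolding std_normal_density_def
  by (rule derivative_eq_intros assms refl | simp)+

lemma continuous_std_normal_density: "continuous_on S std_normal_density"
  unfolding std_normal_density_def by (intro continuous_intros) auto

lemma set_integrable_std_normal_density:
  "A \<in> sets borel \<Longrightarrow> set_integrable lborel A std_normal_density"
  unfolding set_integrable_def
  by (intro integrable_mult_indicator) auto

lemma has_real_derivative_std_normal_cdf:
  "(std_normal_cdf has_real_derivative std_normal_density x) (at x)"
proof -
  \<comment> \<open>The improper integral is split at the fixed point \<open>x - 1\<close>; only a
    compact interval then varies with \<open>u\<close>, and \<open>x\<close> lies in the interior of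
    \<open>{x - 1..x + 1}\<close>, so the derivative within that interval is the full
    derivative.\<close>
  have eq: "std_normal_cdf (x - 1) + integral {x - 1..u} std_normal_density = std_normal_cdf u"
    if "u \<in> {x - 1..x + 1}" for u
  proof -
    have "std_normal_cdf u = (LINT s:{..x-1} \<union> {x-1<..u}|lborel. std_normal_density s)"
      using that by (simp add: std_normal_cdf_def ivl_disj_un)
    also have "\<dots> = std_normal_cdf (x - 1) + (LINT s:{x-1<..u}|lborel. std_normal_density s)"
      unfolding std_normal_cdf_def
      by (intro set_integral_Un set_integrable_std_normal_density) auto
    also have "(LINT s:{x-1<..u}|lborel. std_normal_density s)
        = (LBINT s=ereal (x-1)..ereal u. std_normal_density s)"
      using that by (subst interval_integral_Ioc) auto
    also have "\<dots> = integral {x-1..u} std_normal_density"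
      using that by (intro interval_integral_eq_integral set_integrable_std_normal_density) auto
    finally show ?thesis by simp
  qed
  have "((\<lambda>u. std_normal_cdf (x - 1) + integral {x - 1..u} std_normal_density) has_real_derivative
      0 + std_normal_density x) (at x within {x - 1..x + 1})"
    by (intro derivative_intros integral_has_real_derivative continuous_std_normal_density) auto
  then have "(std_normal_cdf has_real_derivative 0 + std_normal_density x) (at x within {x - 1..x + 1})"
    unfolding has_field_derivative_def
    by (rule has_derivative_transform[rotated 2]) (auto simp: eq)
  moreover have "at x within {x - 1..x + 1} = at x"
    by (rule at_within_interior) (simp add: interior_atLeastAtMost_real)
  ultimately show ?thesis by simp
qed

lemma has_bochner_integral_atMost_FTC:
  fixes F f :: "real \<Rightarrow> real"
  assumes F: "\<And>x. (F has_real_derivative f x) (at x)"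
    and f: "\<And>x. isCont f x" "integrable lborel f"
    and lim: "(F \<longlongrightarrow> 0) at_bot"
  shows "has_bochner_integral lborel (\<lambda>x. f x * indicator {..c} x) (F c)"
proof -
  have meas: "f \<in> borel_measurable borel"
    using f(1) by (intro borel_measurable_continuous_onI) (simp add: continuous_on_eq_continuous_at)
  have int: "set_integrable lborel A f" if "A \<in> sets borel" for A
    using f(2) that unfolding set_integrable_def by (intro integrable_mult_indicator) auto
  have "(LBINT x=-\<infinity>..ereal c. f x) = F c - 0"
  proof (rule interval_integral_FTC_integrable)
    show "((F \<circ> real_of_ereal) \<longlongrightarrow> F c) (at_left (ereal c))"
      using DERIV_isCont[OF F, of c] unfolding ereal_tendsto_simps
      by (auto simp: isCont_def intro: filterlim_at_split[THEN iffD1, THEN conjunct1])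
  qed (use F f int lim in \<open>auto simp: ereal_tendsto_simps has_real_derivative_iff_has_vector_derivative\<close>)
  also have "(LBINT x=-\<infinity>..ereal c. f x) = (LINT x:{..<c}|lborel. f x)"
    by (simp add: interval_lebesgue_integral_def)
  \<comment> \<open>The interval integral up to \<open>c\<close> runs over the open half-line;
    adding the null set \<open>{c}\<close> changes nothing.\<close>
  also have "\<dots> = (LINT x:{..c}|lborel. f x)"
    unfolding set_lebesgue_integral_def
    using AE_lborel_singleton[of c] meas
    by (intro integral_cong_AE) (auto simp: indicator_def elim!: eventually_mono)
  finally show ?thesis
    using int[of "{..c}"]
    by (simp add: has_bochner_integral_iff set_lebesgue_integral_def set_integrable_def mult.commute)
qed

text \<open>The weight \<open>p\<close> will be the indicator of one side of the switching surface.
  Orders up to 2 suffice because an affine map times x - mu is quadratic.\<close>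

definition gauss_moments :: "(real \<Rightarrow> real) \<Rightarrow> real \<Rightarrow> real \<Rightarrow> real \<Rightarrow> bool" where
  "gauss_moments p m0 m1 m2 \<longleftrightarrow> p \<in> borel_measurable borel \<and>
     has_bochner_integral lborel (\<lambda>t. std_normal_density t * p t) m0 \<and>
     has_bochner_integral lborel (\<lambda>t. std_normal_density t * p t * t) m1 \<and>
     has_bochner_integral lborel (\<lambda>t. std_normal_density t * p t * t\<^sup>2) m2"

lemma gauss_moments_one: "gauss_moments (\<lambda>_. 1) 1 0 1"
  using std_normal_moment_even[of 0] std_normal_moment_odd[of 0] std_normal_moment_even[of 1]
  by (simp add: gauss_moments_def)

lemma gauss_moments_diff:
  assumes "gauss_moments p m0 m1 m2" "gauss_moments q k0 k1 k2"
  shows "gauss_moments (\<lambda>t. p t - q t) (m0 - k0) (m1 - k1) (m2 - k2)"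
  using assms unfolding gauss_moments_def
  by (auto intro!: has_bochner_integral_diff simp: right_diff_distrib left_diff_distrib)

text \<open>With phi the standard density, t phi(t) has the antiderivative - phi(t), and t^2 phi(t)
  - phi(t) has - t phi(t); both vanish at minus infinity. The second moment follows by adding back
  the moment of order 0.\<close>

lemma gauss_moments_atMost:
  "gauss_moments (indicator {..c}) (std_normal_cdf c) (- std_normal_density c)
     (std_normal_cdf c - c * std_normal_density c)"
proof -
  have 0: "has_bochner_integral lborel (\<lambda>t. std_normal_density t * indicator {..c} t) (std_normal_cdf c)"
    using set_integrable_std_normal_density[of "{..c}"]
    by (simp add: has_bochner_integral_iff std_normal_cdf_def set_lebesgue_integral_def
        set_integrable_def mult.commute)
  have cont: "isCont std_normal_density x" for x
    using continuous_std_normal_density[of UNIV] by (simp add: continuous_on_eq_continuous_at)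
  have 1: "has_bochner_integral lborel (\<lambda>t. (t * std_normal_density t) * indicator {..c} t) (- std_normal_density c)"
  proof (rule has_bochner_integral_atMost_FTC)
    show "((\<lambda>x. - std_normal_density x) \<longlongrightarrow> 0) at_bot"
      unfolding std_normal_density_def by real_asymp
    show "integrable lborel (\<lambda>t. t * std_normal_density t)"
      using integrable_std_normal_moment[of 1] by (simp add: mult.commute)
  qed (auto intro!: derivative_eq_intros continuous_intros cont)
  have "has_bochner_integral lborel (\<lambda>t. (t\<^sup>2 * std_normal_density t - std_normal_density t) * indicator {..c} t)
      (- c * std_normal_density c)"
  proof (rule has_bochner_integral_atMost_FTC)
    show "((\<lambda>x. - x * std_normal_density x) \<longlongrightarrow> 0) at_bot"
      unfolding std_normal_density_def by real_asymp
    show "integrable lborel (\<lambda>t. t\<^sup>2 * std_normal_density t - std_normal_density t)"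
      using integrable_std_normal_moment[of 2] integrable_std_normal_moment[of 0]
      by (intro Bochner_Integration.integrable_diff) (auto simp: mult.commute)
  qed (auto intro!: derivative_eq_intros continuous_intros cont simp: power2_eq_square algebra_simps)
  from has_bochner_integral_add[OF this 0] 0 1 show ?thesis
    unfolding gauss_moments_def by (simp add: algebra_simps)
qed

section \<open>Moments of the product of standard normals\<close>

definition std_gauss :: "real^'n \<Rightarrow> real" where
  "std_gauss z = (\<Prod>i\<in>UNIV. std_normal_density (z $ i))"

lemma borel_measurable_std_gauss [measurable]: "std_gauss \<in> borel_measurable borel"
  unfolding std_gauss_def by measurable

text \<open>The product form serves coordinatewise integration; this exponential form is the one to
  compare with \<open>mv_normal_density\<close>.\<close>

lemma std_gauss_eq:
  fixes z :: "real^'n"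
  shows "std_gauss z = exp (- (z \<bullet> z) / 2) / sqrt ((2 * pi) ^ CARD('n))"
proof -
  have "std_gauss z = (\<Prod>i\<in>UNIV. exp (- (z $ i)\<^sup>2 / 2)) / sqrt (2 * pi) ^ CARD('n)"
    by (simp add: std_gauss_def std_normal_density_def prod_dividef)
  also have "(\<Prod>i\<in>UNIV. exp (- (z $ i)\<^sup>2 / 2)) = exp (- (z \<bullet> z) / 2)"
    by (simp add: exp_sum[symmetric] inner_vec_def power2_eq_square sum_negf sum_divide_distrib)
  finally show ?thesis
    by (simp only: real_sqrt_power)
qed

text \<open>By independence each integral factors. Every coordinate other than \<open>k\<close>
  contributes a standard moment 1, 0 or 1 of order 0, 1 or 2, while coordinate \<open>k\<close>
  contributes the matching weighted moment.\<close>

lemma std_gauss_moments: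
  fixes k :: "'n::finite"
  assumes "gauss_moments p m0 m1 m2"
  shows "has_bochner_integral lborel (\<lambda>z. std_gauss z * p (z $ k)) m0" (is ?A)
    and "has_bochner_integral lborel (\<lambda>z. std_gauss z * p (z $ k) * z $ i) (if i = k then m1 else 0)" (is ?B)
    and "has_bochner_integral lborel (\<lambda>z. std_gauss z * p (z $ k) * z $ i * z $ j)
           (if i = j then if i = k then m2 else m0 else 0)" (is ?C)
proof -
  have p: "has_bochner_integral lborel (\<lambda>t. std_normal_density t * p t) m0"
     "has_bochner_integral lborel (\<lambda>t. std_normal_density t * p t * t) m1"
     "has_bochner_integral lborel (\<lambda>t. std_normal_density t * p t * (t * t)) m2"
    using assms by (auto simp: gauss_moments_def power2_eq_square)
  have o: "has_bochner_integral lborel (\<lambda>t. std_normal_density t) 1"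
     "has_bochner_integral lborel (\<lambda>t. std_normal_density t * t) 0"
     "has_bochner_integral lborel (\<lambda>t. std_normal_density t * (t * t)) 1"
    using gauss_moments_one by (auto simp: gauss_moments_def power2_eq_square)
  have "has_bochner_integral lborel
      (\<lambda>z. \<Prod>b\<in>UNIV. std_normal_density (z $ b) * (if b = k then p (z $ b) else 1))
      (\<Prod>b\<in>UNIV. if b = k then m0 else 1)"
    by (intro has_bochner_integral_lborel_prod) (use p o in auto)
  then show ?A
    by (simp add: std_gauss_def prod.distrib)
  have "has_bochner_integral lborel
      (\<lambda>z. \<Prod>b\<in>UNIV. std_normal_density (z $ b) * (if b = k then p (z $ b) else 1) *
        (if b = i then z $ b else 1))
      (\<Prod>b\<in>UNIV. if b = i then if b = k then m1 else 0 else if b = k then m0 else 1)"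
    by (intro has_bochner_integral_lborel_prod) (use p o in auto)
  moreover have "(\<Prod>b\<in>UNIV. if b = i then if b = k then m1 else 0 else if b = k then m0 else 1)
      = (if i = k then m1 else 0)"
    by (cases "i = k") (auto intro!: prod_zero simp: prod.delta cong: if_cong)
  ultimately show ?B
    by (simp add: std_gauss_def prod.distrib)
  \<comment> \<open>Conditional factors equal to 1 away from \<open>i\<close>, \<open>j\<close>,
    \<open>k\<close> write the integrand as one product over all coordinates; both factors coincide
    at one coordinate exactly when \<open>i = j\<close>.\<close>
  have "has_bochner_integral lborel
      (\<lambda>z. \<Prod>b\<in>UNIV. std_normal_density (z $ b) * (if b = k then p (z $ b) else 1) *
        ((if b = i then z $ b else 1) * (if b = j then z $ b else 1)))
      (\<Prod>b\<in>UNIV. if b = i \<and> b = j then if b = k then m2 else 1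
        else if b = i \<or> b = j then if b = k then m1 else 0 else if b = k then m0 else 1)"
    by (intro has_bochner_integral_lborel_prod) (use p o in auto)
  moreover have "(\<Prod>b\<in>UNIV. if b = i \<and> b = j then if b = k then m2 else 1
        else if b = i \<or> b = j then if b = k then m1 else 0 else if b = k then m0 else 1)
      = (if i = j then if i = k then m2 else m0 else 0)"
  proof (cases "i = j")
    case True
    have "(\<Prod>b\<in>UNIV. if b = i then if b = k then m2 else 1 else if b = k then m0 else 1)
        = (\<Prod>b\<in>UNIV. if b = k then if i = k then m2 else m0 else 1)"
      by (intro prod.cong) auto
    also have "\<dots> = (if i = k then m2 else m0)" by simp
    finally have *: "(\<Prod>b\<in>UNIV. if b = i then if b = k then m2 else 1 else if b = k then m0 else 1)
        = (if i = k then m2 else m0)" .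
    have "(b = i \<and> b = j) = (b = i)" "(b = i \<or> b = j) = (b = i)" for b
      using True by auto
    then have "(\<Prod>b\<in>UNIV. if b = i \<and> b = j then if b = k then m2 else 1
        else if b = i \<or> b = j then if b = k then m1 else 0 else if b = k then m0 else 1)
      = (\<Prod>b\<in>UNIV. if b = i then if b = k then m2 else 1 else if b = k then m0 else 1)"
      by (intro prod.cong) auto
    then show ?thesis unfolding if_P[OF True] using * by (rule trans)
  next
    case False
    \<comment> \<open>If \<open>i\<close> and \<open>j\<close> differ, one of them is not
      \<open>k\<close>; the vanishing first moment there makes the product 0.\<close>
    then have "\<exists>b. b \<noteq> k \<and> (b = i \<or> b = j)" by metis
    with False show ?thesis by (auto intro!: prod_zero)
  qed
  ultimately show ?C
    by (simp add: std_gauss_def prod.distrib mult.assoc)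
qed

subsection \<open>Whitening of a multivariate normal distribution\<close>

lemma outer_prod_mult_left: "outer_prod (A *v u) v = A ** outer_prod u v"
  by (simp add: outer_prod_def vec_eq_iff matrix_vector_mult_def matrix_matrix_mult_def
      sum_distrib_right mult.assoc)

lemma outer_prod_mult_right: "outer_prod u (A *v v) = outer_prod u v ** transpose A"
  by (simp add: outer_prod_def vec_eq_iff matrix_vector_mult_def matrix_matrix_mult_def
      transpose_def sum_distrib_left mult_ac)

lemma outer_prod_add_left: "outer_prod (u + u') v = outer_prod u v + outer_prod u' v"
  by (simp add: outer_prod_def vec_eq_iff algebra_simps)

lemma outer_prod_diff_left: "outer_prod (u - u') v = outer_prod u v - outer_prod u' v"
  by (simp add: outer_prod_def vec_eq_iff algebra_simps)

lemma outer_prod_scaleR_left: "outer_prod (c *\<^sub>R u) v = c *\<^sub>R outer_prod u v"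
  by (simp add: outer_prod_def vec_eq_iff)

lemma outer_prod_scaleR_right: "outer_prod u (c *\<^sub>R v) = c *\<^sub>R outer_prod u v"
  by (simp add: outer_prod_def vec_eq_iff)

lemma outer_prod_mult_vector: "outer_prod u v *v h = (v \<bullet> h) *\<^sub>R u"
  by (simp add: outer_prod_def vec_eq_iff matrix_vector_mult_def inner_vec_def sum_distrib_right
      sum_distrib_left mult_ac)

lemma matrix_add_rdistrib: "(A + B) ** C = A ** C + B ** (C::real^'n^'m)"
  by (simp add: vec_eq_iff matrix_matrix_mult_def sum.distrib algebra_simps)

lemma matrix_diff_rdistrib: "(A - B) ** C = A ** C - B ** (C::real^'n^'m)"
  by (simp add: vec_eq_iff matrix_matrix_mult_def sum_subtractf algebra_simps)

lemma bounded_linear_matrix_mult_left: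
  "bounded_linear (\<lambda>X::real^'n^'n. (A::real^'n^'n) ** X)"
  unfolding linear_conv_bounded_linear[symmetric]
  by (intro linearI) (simp_all add: vec_eq_iff
      matrix_matrix_mult_def sum.distrib sum_distrib_left algebra_simps)

lemma bounded_linear_matrix_mult_right:
  "bounded_linear (\<lambda>X::real^'n^'n. X ** (A::real^'n^'n))"
  unfolding linear_conv_bounded_linear[symmetric]
  by (intro linearI) (simp_all add: vec_eq_iff
      matrix_matrix_mult_def sum.distrib sum_distrib_left algebra_simps)

lemma bounded_linear_outer_prod_right: "bounded_linear (outer_prod u)"
  unfolding linear_conv_bounded_linear[symmetric]
  by (intro linearI) (simp_all add: outer_prod_def vec_eq_iff algebra_simps)

lemma inner_matrix_vector: "x \<bullet> (A *v y) = (transpose A *v x) \<bullet> (y::real^'n)"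
  by (simp add: dot_lmul_matrix)

text \<open>Gram-Schmidt for the inner product \<open>x\<^sup>T S y\<close>, started at the normalised \<open>g\<close>: the
  columns of \<open>W\<close> form an orthonormal basis whose \<open>k\<close>-th member is parallel to \<open>g\<close>.\<close>

lemma spd_whitening:
  fixes S :: "real^'n^'n" and g :: "real^'n" and k :: 'n
  assumes S: "spd S" and g: "g \<noteq> 0"
  obtains W where "transpose W ** S ** W = mat 1"
    "g = sqrt (g \<bullet> (S *v g)) *\<^sub>R column k W"
proof -
  have pos: "x \<bullet> (S *v x) > 0" if "x \<noteq> 0" for x
    using S that by (simp add: spd_def)
  have sym: "x \<bullet> (S *v y) = y \<bullet> (S *v x)" for x y
    using S by (simp add: inner_matrix_vector[of x] inner_commute spd_def del: transpose_matrix_vector)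
  have normalised: "((1 / sqrt (x \<bullet> (S *v x))) *\<^sub>R x) \<bullet> (S *v ((1 / sqrt (x \<bullet> (S *v x))) *\<^sub>R x)) = 1"
    if "x \<noteq> 0" for x
    using pos[OF that] by (simp add: matrix_vector_mult_scaleR)
  \<comment> \<open>Index \<open>k\<close> belongs to the family from the start, so the normalised
    \<open>g\<close> is its first vector; \<open>I\<close> grows to all of
    \<open>UNIV\<close>.\<close>
  have "\<exists>w. (\<forall>i\<in>insert k I. \<forall>j\<in>insert k I. w i \<bullet> (S *v w j) = (if i = j then 1 else 0)) \<and>
      w k = (1 / sqrt (g \<bullet> (S *v g))) *\<^sub>R g" if "finite I" for I :: "'n set"
    using that
  proof induction
    case empty
    show ?case
      by (rule exI[of _ "\<lambda>_. (1 / sqrt (g \<bullet> (S *v g))) *\<^sub>R g"]) (simp add: normalised[OF g] del: inner_scaleR_left)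
  next
    case (insert a I)
    then obtain w where w: "\<And>i j. i \<in> insert k I \<Longrightarrow> j \<in> insert k I \<Longrightarrow> w i \<bullet> (S *v w j) = (if i = j then 1 else 0)"
      and wk: "w k = (1 / sqrt (g \<bullet> (S *v g))) *\<^sub>R g"
      by blast
    show ?case
    proof (cases "a = k")
      case True
      then have "insert k (insert a I) = insert k I" by auto
      then show ?thesis using w wk by metis
    next
      case False
      let ?T = "(\<lambda>i. S *v w i) ` insert k I"
      have a: "a \<notin> insert k I" using False insert by simp
      \<comment> \<open>Fewer than n vectors S w_i span a proper subspace, so some nonzero
        \<open>x\<close> is orthogonal to all of them in the ordinary sense, that is, orthogonal to
        every w_i for the inner product given by \<open>S\<close>.\<close>
      have "dim ?T \<le> card ?T"
        by (rule dim_le_card') (simp add: insert)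
      also have "\<dots> \<le> card (insert k I)"
        by (rule card_image_le) (simp add: insert)
      also have "\<dots> < CARD('n)"
        using a by (intro psubset_card_mono) auto
      finally have "dim ?T < DIM(real^'n)" by simp
      then obtain x where x: "x \<noteq> 0" and orth: "\<And>y. y \<in> span ?T \<Longrightarrow> orthogonal x y"
        using orthogonal_to_subspace_exists by blast
      have x0: "x \<bullet> (S *v w i) = 0" if "i \<in> insert k I" for i
        using orth[of "S *v w i"] that by (auto simp: orthogonal_def intro: span_base)
      have x0': "w i \<bullet> (S *v x) = 0" if "i \<in> insert k I" for i
        using x0[OF that] sym[of "w i" x] by simp
      define v where "v = w(a := (1 / sqrt (x \<bullet> (S *v x))) *\<^sub>R x)"
      have va: "v a = (1 / sqrt (x \<bullet> (S *v x))) *\<^sub>R x" and vi: "\<And>i. i \<in> insert k I \<Longrightarrow> v i = w i"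
        using a by (auto simp: v_def)
      have "v i \<bullet> (S *v v j) = (if i = j then 1 else 0)"
        if "i \<in> insert k (insert a I)" "j \<in> insert k (insert a I)" for i j
      proof -
        have ia: "i = a \<or> i \<in> insert k I" and ja: "j = a \<or> j \<in> insert k I"
          using that by auto
        show ?thesis
        proof (cases "i = a")
          case True
          show ?thesis
          proof (cases "j = a")
            case True
            with \<open>i = a\<close> show ?thesis using normalised[OF x] by (simp only: va if_True simp_thms)
          next
            case False
            with ja have "j \<in> insert k I" by simp
            then have "v i \<bullet> (S *v v j) = 0"
              unfolding vi[OF \<open>j \<in> insert k I\<close>] \<open>i = a\<close> va using x0 by simp
            then show ?thesis using False \<open>i = a\<close> by simp
          qed
        next
          case False
          with ia have i: "i \<in> insert k I" by simp
          show ?thesis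
          proof (cases "j = a")
            case True
            have "v i \<bullet> (S *v v j) = 0"
              unfolding vi[OF i] \<open>j = a\<close> va using x0'[OF i] by (simp add: matrix_vector_mult_scaleR)
            then show ?thesis using False \<open>j = a\<close> by simp
          next
            case False
            with ja have "j \<in> insert k I" by simp
            then show ?thesis using w i vi by metis
          qed
        qed
      qed
      moreover have "v k = (1 / sqrt (g \<bullet> (S *v g))) *\<^sub>R g"
        using vi wk by simp
      ultimately show ?thesis by blast
    qed
  qed
  from this[of UNIV] obtain w where w: "\<And>i j. w i \<bullet> (S *v w j) = (if i = j then 1 else 0)"
    and wk: "w k = (1 / sqrt (g \<bullet> (S *v g))) *\<^sub>R g"
    by auto
  define W where "W = (\<chi> i j. w j $ i)"
  have col: "column j W = w j" for j
    by (simp add: W_def column_def vec_eq_iff)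
  have "(transpose W ** S ** W) $ i $ j = w i \<bullet> (S *v w j)" for i j
  proof -
    have "(transpose W ** (S ** W)) $ i $ j = column i W \<bullet> column j (S ** W)"
      by (simp add: matrix_matrix_mult_def transpose_def column_def inner_vec_def)
    also have "column j (S ** W) = S *v column j W"
      by (simp add: matrix_matrix_mult_def matrix_vector_mult_def column_def)
    finally show ?thesis by (simp add: col matrix_mul_assoc)
  qed
  then have "transpose W ** S ** W = mat 1"
    by (simp add: vec_eq_iff mat_def w)
  moreover have "g = sqrt (g \<bullet> (S *v g)) *\<^sub>R column k W"
    using pos[OF g] by (simp add: col wk)
  ultimately show ?thesis by (rule that)
qed

text \<open>The hypothesis makes W^T S a left inverse of \<open>W\<close>; for square matrices it is
  also a right inverse, and reassociating gives the inverse of \<open>S\<close>. Determinants of the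
  hypothesis give the rest.\<close>

lemma whitening_inverse:
  fixes S W :: "real^'n^'n"
  assumes W: "transpose W ** S ** W = mat 1"
  shows "S ** (W ** transpose W) = mat 1" and "matrix_inv S = W ** transpose W"
    and "det S * (det W)\<^sup>2 = 1" and "det S > 0"
proof -
  have "W ** (transpose W ** S) = mat 1"
    using W matrix_left_right_inverse by blast
  then have 1: "(W ** transpose W) ** S = mat 1" by (simp add: matrix_mul_assoc)
  then show 2: "S ** (W ** transpose W) = mat 1"
    using matrix_left_right_inverse by blast
  show "matrix_inv S = W ** transpose W"
    \<comment> \<open>\<open>matrix_inv\<close> is a choice of a two-sided inverse, so uniqueness
      has to be shown as well.\<close>
    unfolding matrix_inv_def
  proof (rule some_equality)
    fix B assume B: "S ** B = mat 1 \<and> B ** S = mat 1"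
    then have "B = B ** (S ** (W ** transpose W))" by (simp add: 2)
    also have "\<dots> = (B ** S) ** (W ** transpose W)" by (simp add: matrix_mul_assoc)
    finally show "B = W ** transpose W" using B by simp
  qed (use 1 2 in simp)
  have "det (transpose W ** S ** W) = 1" by (simp add: W)
  then show 3: "det S * (det W)\<^sup>2 = 1"
    by (simp add: det_mul power2_eq_square mult_ac)
  have "\<not> det S \<le> 0"
    using mult_nonpos_nonneg[of "det S" "(det W)\<^sup>2"] 3 by auto
  then show "det S > 0" by simp
qed

section \<open>Expectations under the multivariate normal\<close>

lemma borel_measurable_mv_normal_density [measurable]:
  "mv_normal_density \<mu> S \<in> borel_measurable borel"
  unfolding mv_normal_density_def by measurable

text \<open>For L = S W one has L^T S^-1 L = W^T S W = 1, so the exponent becomes - |z|^2 / 2. From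
  det S (det W)^2 = 1 the Jacobian factor |det L| equals sqrt (det S), which cancels the
  normalisation.\<close>

lemma mv_normal_density_whitening:
  fixes S W :: "real^'n^'n"
  assumes S: "spd S" and W: "transpose W ** S ** W = mat 1"
  shows "\<bar>det (S ** W)\<bar> * mv_normal_density \<mu> S (\<mu> + (S ** W) *v z) = std_gauss z"
    and "det (S ** W) \<noteq> 0"
proof -
  note inv = whitening_inverse[OF W]
  have "det S > 0" by (rule inv(4))
  then have "sqrt (det S) > 0" by simp
  have "(sqrt (det S) * \<bar>det W\<bar>)\<^sup>2 = 1"
    using inv(3) \<open>det S > 0\<close> by (simp add: power_mult_distrib)
  then have sW: "sqrt (det S) * \<bar>det W\<bar> = 1"
    using \<open>sqrt (det S) > 0\<close> by (intro power2_eq_imp_eq[of _ 1]) auto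
  have d: "\<bar>det (S ** W)\<bar> = sqrt (det S)"
  proof -
    have "\<bar>det (S ** W)\<bar> = sqrt (det S) * (sqrt (det S) * \<bar>det W\<bar>)"
      using \<open>det S > 0\<close> by (simp add: det_mul abs_mult)
    then show ?thesis by (simp add: sW)
  qed
  with \<open>sqrt (det S) > 0\<close> show "det (S ** W) \<noteq> 0" by auto
  have "((S ** W) *v z) \<bullet> (matrix_inv S *v ((S ** W) *v z)) = ((S ** W) *v z) \<bullet> (W *v z)"
  proof -
    have "matrix_inv S ** S = mat 1"
      using inv(1,2) matrix_left_right_inverse by metis
    then show ?thesis by (simp add: matrix_vector_mul_assoc matrix_mul_assoc)
  qed
  also have "\<dots> = ((transpose W ** S ** W) *v z) \<bullet> z"
    unfolding inner_matrix_vector[of _ W] by (simp add: matrix_vector_mul_assoc matrix_mul_assoc del: transpose_matrix_vector)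
  also have "\<dots> = z \<bullet> z" by (simp add: W)
  finally show "\<bar>det (S ** W)\<bar> * mv_normal_density \<mu> S (\<mu> + (S ** W) *v z) = std_gauss z"
    using \<open>det S > 0\<close> unfolding d mv_normal_density_def std_gauss_eq
    by (simp add: real_sqrt_mult)
qed

lemma sets_mv_normal [simp]: "sets (mv_normal \<mu> S) = sets lebesgue"
  by (simp add: mv_normal_def)

lemma borel_measurable_mv_normal:
  "borel_measurable (mv_normal \<mu> S) = borel_measurable lebesgue"
  by (rule measurable_cong_sets) simp_all

lemma has_bochner_integral_mv_normal:
  fixes S W :: "real^'n^'n" and F :: "real^'n \<Rightarrow> 'b::{banach,second_countable_topology}"
  assumes S: "spd S" and W: "transpose W ** S ** W = mat 1"
    and [measurable]: "F \<in> borel_measurable borel"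
    and int: "has_bochner_integral lborel (\<lambda>z. std_gauss z *\<^sub>R F (\<mu> + (S ** W) *v z)) I"
  shows "has_bochner_integral (mv_normal \<mu> S) F I"
proof -
  have "has_bochner_integral lborel (\<lambda>x. mv_normal_density \<mu> S x *\<^sub>R F x) I"
  proof (rule has_bochner_integral_lborel_affine[of "S ** W"])
    show "has_bochner_integral lborel (\<lambda>z. \<bar>det (S ** W)\<bar> *\<^sub>R
        (mv_normal_density \<mu> S (\<mu> + (S ** W) *v z) *\<^sub>R F (\<mu> + (S ** W) *v z))) I"
      using int by (simp add: mv_normal_density_whitening(1)[OF S W])
  qed (use mv_normal_density_whitening(2)[OF S W] in auto)
  \<comment> \<open>For a Borel integrand, passing to the completed measure keeps integrability and
    value.\<close>
  then have "has_bochner_integral lebesgue (\<lambda>x. mv_normal_density \<mu> S x *\<^sub>R F x) I"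
    by (simp add: has_bochner_integral_iff integrable_completion integral_completion)
  then show ?thesis
    unfolding mv_normal_def
  proof (rule has_bochner_integral_density[rotated -1])
    show "AE x in lebesgue. 0 \<le> mv_normal_density \<mu> S x"
      using whitening_inverse(4)[OF W] by (simp add: mv_normal_density_def)
  qed (auto intro!: measurable_completion)
qed

text \<open>Needed because \<open>f\<close> is arbitrary on the switching hyperplane and may fail to
  be Borel there; completeness of Lebesgue measure makes a function that agrees almost everywhere
  with a measurable one measurable.\<close>

lemma has_bochner_integral_mv_normal_negligible:
  fixes F G :: "real^'n \<Rightarrow> 'b::euclidean_space"
  assumes F: "has_bochner_integral (mv_normal \<mu> S) F I"
    and N: "negligible N" and eq: "\<And>x. x \<notin> N \<Longrightarrow> F x = G x"
  shows "has_bochner_integral (mv_normal \<mu> S) G I"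
proof -
  have ae: "AE x in lebesgue. F x = G x"
    using N eq by (intro AE_I'[of N]) (auto simp: negligible_iff_null_sets)
  have Fm: "F \<in> borel_measurable lebesgue"
    using F borel_measurable_integrable[of "mv_normal \<mu> S" F]
    by (simp add: has_bochner_integral_iff borel_measurable_mv_normal)
  then have Gm: "G \<in> borel_measurable lebesgue"
    using ae by (rule borel_measurable_AE)
  have "AE x in mv_normal \<mu> S. F x = G x"
    unfolding mv_normal_def
    by (subst AE_density) (use ae in \<open>auto intro!: measurable_completion\<close>)
  then show ?thesis
    using F Fm Gm has_bochner_integral_cong_AE[of F "mv_normal \<mu> S" G I]
    by (simp add: borel_measurable_mv_normal)
qed

text \<open>In whitened coordinates the weight depends on z_k only, so the moments are m0, m1 e_k
  and m0 I + (m2 - m0) e_k e_k^T. Mapping them by L = S W with L e_k = S g / sigma and L L^T = S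
  gives the claims.\<close>

lemma mv_normal_moments:
  fixes S :: "real^'n^'n" and g :: "real^'n"
  assumes S: "spd S" and g: "g \<noteq> 0" and p: "gauss_moments p m0 m1 m2"
  defines "\<sigma> \<equiv> sqrt (g \<bullet> (S *v g))"
  shows "has_bochner_integral (mv_normal \<mu> S) (\<lambda>x. p (g \<bullet> (x - \<mu>) / \<sigma>)) m0" (is ?A)
    and "has_bochner_integral (mv_normal \<mu> S) (\<lambda>x. p (g \<bullet> (x - \<mu>) / \<sigma>) *\<^sub>R (x - \<mu>))
      ((m1 / \<sigma>) *\<^sub>R (S *v g))" (is ?B)
    and "has_bochner_integral (mv_normal \<mu> S) (\<lambda>x. p (g \<bullet> (x - \<mu>) / \<sigma>) *\<^sub>R outer_prod (x - \<mu>) (x - \<mu>))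
      (m0 *\<^sub>R S + ((m2 - m0) / \<sigma>\<^sup>2) *\<^sub>R outer_prod (S *v g) (S *v g))" (is ?C)
proof -
  \<comment> \<open>Any index can carry the direction \<open>g\<close>; the type is nonempty, so one
    exists.\<close>
  obtain k :: 'n where True by blast
  obtain W where W: "transpose W ** S ** W = mat 1" and gW: "g = \<sigma> *\<^sub>R column k W"
    using spd_whitening[OF S g] unfolding \<sigma>_def by blast
  have [measurable]: "p \<in> borel_measurable borel" using p by (simp add: gauss_moments_def)
  have \<sigma>: "\<sigma> > 0" using S g by (simp add: \<sigma>_def spd_def)
  have tS: "transpose S = S" using S by (simp add: spd_def)
  let ?L = "S ** W"
  have Le: "?L *v axis k 1 = (1 / \<sigma>) *\<^sub>R (S *v g)"
  proof -
    have "S *v g = \<sigma> *\<^sub>R (S *v column k W)"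
      by (subst gW) (simp add: matrix_vector_mult_scaleR)
    then show ?thesis
      using \<sigma> by (simp add: matrix_vector_mul_assoc[symmetric] matrix_vector_mult_basis[of W k]
          del: matrix_vector_mul_assoc matrix_vector_mult_basis)
  qed
  have LL: "?L ** transpose ?L = S"
    using whitening_inverse(1)[OF W] by (simp add: matrix_transpose_mul tS matrix_mul_assoc)
  have gL: "g \<bullet> (?L *v z) / \<sigma> = z $ k" for z
  proof -
    have "g \<bullet> (?L *v z) = (transpose ?L *v g) \<bullet> z"
      by (rule inner_matrix_vector)
    also have "transpose ?L *v g = \<sigma> *\<^sub>R ((transpose W ** S) *v column k W)"
      by (subst gW) (simp add: matrix_vector_mult_scaleR matrix_transpose_mul tS)
    also have "(transpose W ** S) *v column k W = axis k 1"
      by (metis W matrix_vector_mul_assoc matrix_vector_mul_lid matrix_vector_mult_basis)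
    finally show ?thesis
      using \<sigma> by (simp add: inner_axis')
  qed
  note mom = std_gauss_moments[OF p, of k]
  show ?A
    by (rule has_bochner_integral_mv_normal[OF S W]) (use mom(1) in \<open>simp_all add: gL\<close>)
  have "has_bochner_integral lborel (\<lambda>z. (std_gauss z * p (z $ k)) *\<^sub>R z) (m1 *\<^sub>R axis k 1)"
  proof (rule has_bochner_integral_vecI)
    show "has_bochner_integral lborel (\<lambda>z. ((std_gauss z * p (z $ k)) *\<^sub>R z) $ i) ((m1 *\<^sub>R axis k 1) $ i)" for i
      using mom(2)[of i] by (cases "i = k") (simp_all add: axis_def)
  qed
  from has_bochner_integral_bounded_linear[OF matrix_vector_mul_bounded_linear this, of ?L]
  show ?B
    by (intro has_bochner_integral_mv_normal[OF S W])
      (simp_all add: gL matrix_vector_mult_scaleR Le)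
  have "has_bochner_integral lborel (\<lambda>z. (std_gauss z * p (z $ k)) *\<^sub>R outer_prod z z)
      (m0 *\<^sub>R mat 1 + (m2 - m0) *\<^sub>R outer_prod (axis k 1) (axis k 1))"
    (is "has_bochner_integral _ ?f ?v")
  proof (rule has_bochner_integral_vecI, rule has_bochner_integral_vecI)
    show "has_bochner_integral lborel (\<lambda>z. ?f z $ i $ j) (?v $ i $ j)" for i j
      using mom(3)[of i j]
      by (cases "i = j"; cases "i = k"; cases "j = k") (simp_all add: outer_prod_def mat_def axis_def mult.assoc)
  qed
  then have "has_bochner_integral lborel (\<lambda>z. ?L ** ?f z ** transpose ?L) (?L ** ?v ** transpose ?L)"
    by (intro has_bochner_integral_bounded_linear[OF bounded_linear_matrix_mult_right]
        has_bochner_integral_bounded_linear[OF bounded_linear_matrix_mult_left])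
  moreover have "?L ** ?f z ** transpose ?L = (std_gauss z * p (z $ k)) *\<^sub>R outer_prod (?L *v z) (?L *v z)" for z
    by (simp only: outer_prod_mult_left outer_prod_mult_right matrix_mul_assoc
        scalar_matrix_assoc[symmetric] matrix_scalar_ac)
  moreover have "?L ** ?v ** transpose ?L
      = m0 *\<^sub>R S + ((m2 - m0) / \<sigma>\<^sup>2) *\<^sub>R outer_prod (S *v g) (S *v g)"
  proof -
    have "?L ** ?v ** transpose ?L = m0 *\<^sub>R (?L ** transpose ?L)
        + (m2 - m0) *\<^sub>R outer_prod (?L *v axis k 1) (?L *v axis k 1)"
      by (simp only: outer_prod_mult_left outer_prod_mult_right matrix_mul_assoc matrix_mul_rid
          matrix_add_ldistrib matrix_add_rdistrib scalar_matrix_assoc[symmetric] matrix_scalar_ac)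
    then show ?thesis
      by (simp add: LL Le outer_prod_scaleR_left outer_prod_scaleR_right power2_eq_square)
  qed
  moreover have [measurable]: "(\<lambda>x. outer_prod (x - \<mu>) (x - \<mu>)) \<in> borel_measurable borel"
    unfolding outer_prod_def by (intro borel_measurable_continuous_onI continuous_intros)
  ultimately show ?C
    by (intro has_bochner_integral_mv_normal[OF S W]) (simp_all add: gL)
qed

subsection \<open>Piecewise affine right-hand sides\<close>

text \<open>Centring at the mean, A x + b = A (x - mu) + d with \<open>d\<close> the value at the
  mean, reduces everything to the centred moments.\<close>

lemma mv_normal_affine_moments:
  fixes S A :: "real^'n^'n" and g b \<mu> :: "real^'n"
  assumes S: "spd S" and g: "g \<noteq> 0" and p: "gauss_moments p m0 m1 m2"
  defines "\<sigma> \<equiv> sqrt (g \<bullet> (S *v g))" and "d \<equiv> A *v \<mu> + b"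
  shows "has_bochner_integral (mv_normal \<mu> S) (\<lambda>x. p (g \<bullet> (x - \<mu>) / \<sigma>) *\<^sub>R (A *v x + b))
      ((m1 / \<sigma>) *\<^sub>R (A *v (S *v g)) + m0 *\<^sub>R d)" (is ?A)
    and "has_bochner_integral (mv_normal \<mu> S)
      (\<lambda>x. p (g \<bullet> (x - \<mu>) / \<sigma>) *\<^sub>R outer_prod (A *v x + b) (x - \<mu>))
      (m0 *\<^sub>R (A ** S) + ((m2 - m0) / \<sigma>\<^sup>2) *\<^sub>R (A ** outer_prod (S *v g) (S *v g)) +
       (m1 / \<sigma>) *\<^sub>R outer_prod d (S *v g))" (is ?B)
proof -
  note mom = mv_normal_moments[OF S g p, of \<mu>, folded \<sigma>_def]
  have aff: "A *v x + b = A *v (x - \<mu>) + d" for x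
    by (simp add: d_def matrix_vector_mult_diff_distrib)
  have "has_bochner_integral (mv_normal \<mu> S)
      (\<lambda>x. A *v (p (g \<bullet> (x - \<mu>) / \<sigma>) *\<^sub>R (x - \<mu>)) + p (g \<bullet> (x - \<mu>) / \<sigma>) *\<^sub>R d)
      (A *v ((m1 / \<sigma>) *\<^sub>R (S *v g)) + m0 *\<^sub>R d)"
    by (intro has_bochner_integral_add has_bochner_integral_scaleR_left mom(1)
        has_bochner_integral_bounded_linear[OF matrix_vector_mul_bounded_linear mom(2)])
  then show ?A
    unfolding aff by (simp add: matrix_vector_mult_scaleR scaleR_add_right)
  have "has_bochner_integral (mv_normal \<mu> S)
      (\<lambda>x. A ** (p (g \<bullet> (x - \<mu>) / \<sigma>) *\<^sub>R outer_prod (x - \<mu>) (x - \<mu>))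
         + outer_prod d (p (g \<bullet> (x - \<mu>) / \<sigma>) *\<^sub>R (x - \<mu>)))
      (A ** (m0 *\<^sub>R S + ((m2 - m0) / \<sigma>\<^sup>2) *\<^sub>R outer_prod (S *v g) (S *v g))
         + outer_prod d ((m1 / \<sigma>) *\<^sub>R (S *v g)))"
    by (intro has_bochner_integral_add
        has_bochner_integral_bounded_linear[OF bounded_linear_matrix_mult_left mom(3)]
        has_bochner_integral_bounded_linear[OF bounded_linear_outer_prod_right mom(2)])
  then show ?B
    unfolding aff by (simp add: matrix_add_ldistrib matrix_scalar_ac scalar_matrix_assoc[symmetric]
        outer_prod_add_left outer_prod_mult_left outer_prod_scaleR_right scaleR_add_right)
qed

lemma pwa_integrals:
  fixes A\<^sub>1 A\<^sub>2 S :: "real^'n^'n" and b\<^sub>1 b\<^sub>2 g xbar \<mu> :: "real^'n" and f :: "real^'n \<Rightarrow> real^'n"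
  assumes g: "g \<noteq> 0"
    and f1: "\<And>x. g \<bullet> (x - xbar) < 0 \<Longrightarrow> f x = A\<^sub>1 *v x + b\<^sub>1"
    and f2: "\<And>x. g \<bullet> (x - xbar) > 0 \<Longrightarrow> f x = A\<^sub>2 *v x + b\<^sub>2"
    and S: "spd S"
  shows "has_bochner_integral (mv_normal \<mu> S) f (pwa_mean A\<^sub>1 b\<^sub>1 A\<^sub>2 b\<^sub>2 g xbar \<mu> S)" (is ?A)
    and "has_bochner_integral (mv_normal \<mu> S) (\<lambda>x. outer_prod (f x) (x - \<mu>))
      (pwa_cov_half A\<^sub>1 b\<^sub>1 A\<^sub>2 b\<^sub>2 g xbar \<mu> S)" (is ?B)
proof -
  define \<sigma> where "\<sigma> = sqrt (g \<bullet> (S *v g))"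
  have \<sigma>: "\<sigma> > 0" using S g by (simp add: \<sigma>_def spd_def)
  then have \<sigma>2: "g \<bullet> (S *v g) = \<sigma>\<^sup>2" by (simp add: \<sigma>_def)
  define c where "c = (g \<bullet> xbar - g \<bullet> \<mu>) / \<sigma>"
  define \<phi> where "\<phi> = std_normal_density c"
  define \<Phi> where "\<Phi> = std_normal_cdf c"
  have pd: "proj_density g (g \<bullet> xbar) \<mu> S = \<phi> / \<sigma>" and pc: "proj_cdf g (g \<bullet> xbar) \<mu> S = \<Phi>"
    by (simp_all add: proj_density_def proj_cdf_def \<phi>_def \<Phi>_def c_def \<sigma>_def)
  have cs: "g \<bullet> xbar - g \<bullet> \<mu> = c * \<sigma>" using \<sigma> by (simp add: c_def)
  let ?q = "indicator {..c} :: real \<Rightarrow> real" and ?t = "\<lambda>x. g \<bullet> (x - \<mu>) / \<sigma>"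
  let ?d1 = "A\<^sub>1 *v \<mu> + b\<^sub>1" and ?d2 = "A\<^sub>2 *v \<mu> + b\<^sub>2"
  note le = gauss_moments_atMost[of c, folded \<phi>_def \<Phi>_def]
  \<comment> \<open>The other side has weight 1 minus the indicator, hence moments 1 - Phi, phi and
    1 - (Phi - c phi).\<close>
  note gt = gauss_moments_diff[OF gauss_moments_one le]
  note le_int = mv_normal_affine_moments[OF S g le, of \<mu>, folded \<sigma>_def]
  note gt_int = mv_normal_affine_moments[OF S g gt, of \<mu>, folded \<sigma>_def]
  let ?H = "{x. g \<bullet> x = g \<bullet> xbar}"
  have neg: "negligible ?H" using g by (intro negligible_hyperplane) simp
  \<comment> \<open>The indicator assigns the hyperplane itself to the first branch; the choice is
    harmless because the hyperplane is negligible.\<close>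
  have f: "f x = ?q (?t x) *\<^sub>R (A\<^sub>1 *v x + b\<^sub>1) + (1 - ?q (?t x)) *\<^sub>R (A\<^sub>2 *v x + b\<^sub>2)" if "x \<notin> ?H" for x
  proof -
    have "?t x \<le> c \<longleftrightarrow> g \<bullet> x \<le> g \<bullet> xbar"
      using \<sigma> by (simp add: c_def field_simps inner_diff_right)
    then show ?thesis
      using that f1[of x] f2[of x] by (cases "g \<bullet> x < g \<bullet> xbar") (auto simp: inner_diff_right)
  qed
  have "has_bochner_integral (mv_normal \<mu> S) f
     (((- \<phi> / \<sigma>) *\<^sub>R (A\<^sub>1 *v (S *v g)) + \<Phi> *\<^sub>R ?d1) +
      (((0 - - \<phi>) / \<sigma>) *\<^sub>R (A\<^sub>2 *v (S *v g)) + (1 - \<Phi>) *\<^sub>R ?d2))"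
    by (rule has_bochner_integral_mv_normal_negligible
        [OF has_bochner_integral_add[OF le_int(1)[of A\<^sub>1 b\<^sub>1] gt_int(1)[of A\<^sub>2 b\<^sub>2]] neg])
      (simp add: f)
  then show ?A
    by (simp add: pwa_mean_def pd pc algebra_simps matrix_vector_mult_diff_rdistrib)
  have eqB: "?q (?t x) *\<^sub>R outer_prod (A\<^sub>1 *v x + b\<^sub>1) (x - \<mu>) +
      (1 - ?q (?t x)) *\<^sub>R outer_prod (A\<^sub>2 *v x + b\<^sub>2) (x - \<mu>) = outer_prod (f x) (x - \<mu>)"
    if "x \<notin> ?H" for x
    unfolding f[OF that] outer_prod_add_left outer_prod_scaleR_left ..
  let ?O = "outer_prod (S *v g) (S *v g)"
  have "has_bochner_integral (mv_normal \<mu> S) (\<lambda>x. outer_prod (f x) (x - \<mu>))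
     ((\<Phi> *\<^sub>R (A\<^sub>1 ** S) + ((\<Phi> - c * \<phi> - \<Phi>) / \<sigma>\<^sup>2) *\<^sub>R (A\<^sub>1 ** ?O) +
        (- \<phi> / \<sigma>) *\<^sub>R outer_prod ?d1 (S *v g)) +
      ((1 - \<Phi>) *\<^sub>R (A\<^sub>2 ** S) + ((1 - (\<Phi> - c * \<phi>) - (1 - \<Phi>)) / \<sigma>\<^sup>2) *\<^sub>R (A\<^sub>2 ** ?O) +
        ((0 - - \<phi>) / \<sigma>) *\<^sub>R outer_prod ?d2 (S *v g)))"
    by (rule has_bochner_integral_mv_normal_negligible
        [OF has_bochner_integral_add[OF le_int(2)[of A\<^sub>1 b\<^sub>1] gt_int(2)[of A\<^sub>2 b\<^sub>2]] neg eqB])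
  also have "(\<Phi> *\<^sub>R (A\<^sub>1 ** S) + ((\<Phi> - c * \<phi> - \<Phi>) / \<sigma>\<^sup>2) *\<^sub>R (A\<^sub>1 ** ?O) +
        (- \<phi> / \<sigma>) *\<^sub>R outer_prod ?d1 (S *v g)) +
      ((1 - \<Phi>) *\<^sub>R (A\<^sub>2 ** S) + ((1 - (\<Phi> - c * \<phi>) - (1 - \<Phi>)) / \<sigma>\<^sup>2) *\<^sub>R (A\<^sub>2 ** ?O) +
        ((0 - - \<phi>) / \<sigma>) *\<^sub>R outer_prod ?d2 (S *v g))
    = (c * \<phi> / \<sigma>\<^sup>2) *\<^sub>R ((A\<^sub>2 - A\<^sub>1) ** ?O) + (\<phi> / \<sigma>) *\<^sub>R outer_prod (?d2 - ?d1) (S *v g) +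
      \<Phi> *\<^sub>R (A\<^sub>1 ** S) + (1 - \<Phi>) *\<^sub>R (A\<^sub>2 ** S)"
    by (simp add: matrix_diff_rdistrib outer_prod_diff_left algebra_simps)
  also have "\<dots> = pwa_cov_half A\<^sub>1 b\<^sub>1 A\<^sub>2 b\<^sub>2 g xbar \<mu> S"
  proof -
    have tS: "transpose S = S" using S by (simp add: spd_def)
    have SgS: "S ** outer_prod g g ** S = ?O" and gS: "outer_prod u g ** S = outer_prod u (S *v g)" for u
      by (simp_all only: outer_prod_mult_left outer_prod_mult_right tS matrix_mul_assoc)
    have "(c * \<sigma>) * (\<phi> / \<sigma>) * (1 / \<sigma>\<^sup>2) = c * \<phi> / \<sigma>\<^sup>2"
      using \<sigma> by simp
    then show ?thesis
      unfolding pwa_cov_half_def pd pc cs \<sigma>2 SgS gS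
      by (simp only: matrix_scalar_ac scalar_matrix_assoc[symmetric] scaleR_scaleR)
  qed
  finally show ?B .
qed

text \<open>The scale sigma does not depend on the mean, so only the standardised threshold varies:
  the projected density has gradient (g . xbar - g . mu) p / sigma^2 times g, and the projected CDF
  has gradient - p times g. Multiplying by \<open>S\<close> turns each term of the Jacobian into the
  corresponding covariance term.\<close>

lemma pwa_mean_has_derivative:
  fixes A\<^sub>1 A\<^sub>2 S :: "real^'n^'n" and b\<^sub>1 b\<^sub>2 g xbar \<mu> :: "real^'n"
  assumes g: "g \<noteq> 0" and S: "spd S"
  obtains J where
    "((\<lambda>m. pwa_mean A\<^sub>1 b\<^sub>1 A\<^sub>2 b\<^sub>2 g xbar m S) has_derivative (\<lambda>h. J *v h)) (at \<mu>)"
    "J ** S = pwa_cov_half A\<^sub>1 b\<^sub>1 A\<^sub>2 b\<^sub>2 g xbar \<mu> S"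
proof -
  define \<sigma> where "\<sigma> = sqrt (g \<bullet> (S *v g))"
  have \<sigma>: "\<sigma> > 0" using S g by (simp add: \<sigma>_def spd_def)
  then have \<sigma>2: "g \<bullet> (S *v g) = \<sigma>\<^sup>2" by (simp add: \<sigma>_def)
  define p where "p = proj_density g (g \<bullet> xbar) \<mu> S"
  define \<Phi> where "\<Phi> = proj_cdf g (g \<bullet> xbar) \<mu> S"
  let ?u = "\<lambda>m. (g \<bullet> xbar - g \<bullet> m) / \<sigma>"
  let ?d1 = "A\<^sub>1 *v \<mu> + b\<^sub>1" and ?d2 = "A\<^sub>2 *v \<mu> + b\<^sub>2"
  have u: "(?u has_derivative (\<lambda>h. - (g \<bullet> h) / \<sigma>)) (at \<mu>)"
    using \<sigma> by (auto intro!: derivative_eq_intros)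
  have p: "p = std_normal_density (?u \<mu>) / \<sigma>"
    by (simp add: p_def proj_density_def \<sigma>_def)
  have dp: "((\<lambda>m. proj_density g (g \<bullet> xbar) m S) has_derivative
      (\<lambda>h. ((g \<bullet> xbar - g \<bullet> \<mu>) * p / \<sigma>\<^sup>2) * (g \<bullet> h))) (at \<mu>)"
  proof -
    have "((\<lambda>m. std_normal_density (?u m)) has_derivative
        (\<lambda>h. (- (g \<bullet> h) / \<sigma>) * (- ?u \<mu> * std_normal_density (?u \<mu>) * 1))) (at \<mu>)"
      by (rule DERIV_compose_FDERIV[OF _ u]) (rule derivative_intros)+
    from has_derivative_mult_right[OF this, of "1 / \<sigma>"] show ?thesis
      unfolding proj_density_def \<sigma>_def[symmetric]
      by (rule has_derivative_eq_rhs) (use \<sigma> in \<open>simp add: p fun_eq_iff field_simps power2_eq_square\<close>)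
  qed
  have dc: "((\<lambda>m. proj_cdf g (g \<bullet> xbar) m S) has_derivative (\<lambda>h. - p * (g \<bullet> h))) (at \<mu>)"
    unfolding proj_cdf_def \<sigma>_def[symmetric]
    by (rule has_derivative_eq_rhs[OF DERIV_compose_FDERIV[OF has_real_derivative_std_normal_cdf u]])
      (simp add: p fun_eq_iff)
  \<comment> \<open>The terms come from the derivative of the density, from the two opposite
    derivatives of the CDF weights, and from the two affine branches.\<close>
  define J where "J = ((g \<bullet> xbar - g \<bullet> \<mu>) * p / \<sigma>\<^sup>2) *\<^sub>R outer_prod ((A\<^sub>2 - A\<^sub>1) *v (S *v g)) g +
    p *\<^sub>R outer_prod (?d2 - ?d1) g + \<Phi> *\<^sub>R A\<^sub>1 + (1 - \<Phi>) *\<^sub>R A\<^sub>2"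
  have lin: "((\<lambda>m. A *v m) has_derivative (\<lambda>h. A *v h)) (at \<mu>)" for A :: "real^'n^'n"
    by (intro bounded_linear_imp_has_derivative matrix_vector_mul_bounded_linear)
  have "((\<lambda>m. pwa_mean A\<^sub>1 b\<^sub>1 A\<^sub>2 b\<^sub>2 g xbar m S) has_derivative (\<lambda>h. J *v h)) (at \<mu>)"
    unfolding pwa_mean_def
    by (rule derivative_eq_intros dp dc lin refl)+
      (simp add: fun_eq_iff J_def \<Phi>_def matrix_vector_mult_add_rdistrib matrix_vector_mult_diff_rdistrib
        scaleR_matrix_vector_assoc[symmetric] outer_prod_mult_vector algebra_simps)
  moreover have "J ** S = pwa_cov_half A\<^sub>1 b\<^sub>1 A\<^sub>2 b\<^sub>2 g xbar \<mu> S"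
    unfolding J_def pwa_cov_half_def p_def[symmetric] \<Phi>_def[symmetric] \<sigma>2
    by (simp add: matrix_add_rdistrib scalar_matrix_assoc[symmetric] matrix_scalar_ac
        outer_prod_mult_left matrix_mul_assoc)
  ultimately show ?thesis by (rule that)
qed

theorem proposition2:
  fixes A\<^sub>1 A\<^sub>2 :: "real^'n^'n" and b\<^sub>1 b\<^sub>2 g xbar :: "real^'n" and f :: "real^'n \<Rightarrow> real^'n"
  assumes "g \<noteq> 0"
    and "\<And>x. g \<bullet> (x - xbar) < 0 \<Longrightarrow> f x = A\<^sub>1 *v x + b\<^sub>1"
    and "\<And>x. g \<bullet> (x - xbar) > 0 \<Longrightarrow> f x = A\<^sub>2 *v x + b\<^sub>2"
  shows "(\<forall>\<mu> \<Sigma>. spd \<Sigma> \<longrightarrow>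
            integrable (mv_normal \<mu> \<Sigma>) f \<and>
            integrable (mv_normal \<mu> \<Sigma>) (\<lambda>x. outer_prod (f x) (x - \<mu>)) \<and>
            mean_rhs f \<mu> \<Sigma> = pwa_mean A\<^sub>1 b\<^sub>1 A\<^sub>2 b\<^sub>2 g xbar \<mu> \<Sigma> \<and>
            (\<lambda>m. mean_rhs f m \<Sigma>) differentiable (at \<mu>) \<and>
            cov_rhs f \<mu> \<Sigma> = jacobian_cov (mean_rhs f) \<mu> \<Sigma> \<and>
            cov_rhs f \<mu> \<Sigma> = pwa_cov A\<^sub>1 b\<^sub>1 A\<^sub>2 b\<^sub>2 g xbar \<mu> \<Sigma>) \<and>
         (\<forall>T \<mu>\<^sub>0 \<Sigma>\<^sub>0 m S.
            (solves_moment_ivp (mean_rhs f) (cov_rhs f) T \<mu>\<^sub>0 \<Sigma>\<^sub>0 m S \<longleftrightarrow>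
             solves_moment_ivp (pwa_mean A\<^sub>1 b\<^sub>1 A\<^sub>2 b\<^sub>2 g xbar)
               (jacobian_cov (pwa_mean A\<^sub>1 b\<^sub>1 A\<^sub>2 b\<^sub>2 g xbar)) T \<mu>\<^sub>0 \<Sigma>\<^sub>0 m S) \<and>
            (solves_moment_ivp (mean_rhs f) (cov_rhs f) T \<mu>\<^sub>0 \<Sigma>\<^sub>0 m S \<longleftrightarrow>
             solves_moment_ivp (pwa_mean A\<^sub>1 b\<^sub>1 A\<^sub>2 b\<^sub>2 g xbar)
               (pwa_cov A\<^sub>1 b\<^sub>1 A\<^sub>2 b\<^sub>2 g xbar) T \<mu>\<^sub>0 \<Sigma>\<^sub>0 m S))"
proof -
  let ?F = "pwa_mean A\<^sub>1 b\<^sub>1 A\<^sub>2 b\<^sub>2 g xbar" and ?G = "pwa_cov A\<^sub>1 b\<^sub>1 A\<^sub>2 b\<^sub>2 g xbar"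
  have int: "has_bochner_integral (mv_normal \<mu> \<Sigma>) f (?F \<mu> \<Sigma>)"
    "has_bochner_integral (mv_normal \<mu> \<Sigma>) (\<lambda>x. outer_prod (f x) (x - \<mu>))
      (pwa_cov_half A\<^sub>1 b\<^sub>1 A\<^sub>2 b\<^sub>2 g xbar \<mu> \<Sigma>)" if "spd \<Sigma>" for \<mu> \<Sigma>
    using assms that by (auto intro!: pwa_integrals)
  have mean: "mean_rhs f \<mu> \<Sigma> = ?F \<mu> \<Sigma>" if "spd \<Sigma>" for \<mu> \<Sigma>
    using int(1)[OF that] by (simp add: mean_rhs_def has_bochner_integral_iff)
  have cov: "cov_rhs f \<mu> \<Sigma> = ?G \<mu> \<Sigma>" if "spd \<Sigma>" for \<mu> \<Sigma>
    using int(2)[OF that] by (simp add: cov_rhs_def pwa_cov_def has_bochner_integral_iff)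
  have jac: "(\<lambda>m. ?F m \<Sigma>) differentiable (at \<mu>) \<and> jacobian_cov ?F \<mu> \<Sigma> = ?G \<mu> \<Sigma>"
    if S: "spd \<Sigma>" for \<mu> \<Sigma>
  proof -
    obtain J where J: "((\<lambda>m. ?F m \<Sigma>) has_derivative (\<lambda>h. J *v h)) (at \<mu>)"
      and JS: "J ** \<Sigma> = pwa_cov_half A\<^sub>1 b\<^sub>1 A\<^sub>2 b\<^sub>2 g xbar \<mu> \<Sigma>"
      using pwa_mean_has_derivative[OF assms(1) S] by blast
    \<comment> \<open>Uniqueness of the derivative identifies the library Jacobian with
      \<open>J\<close>; symmetry of the covariance then makes its product with the transpose of
      \<open>J\<close> the transpose of \<open>J\<close> times the covariance.\<close>
    have "jacobian (\<lambda>m. ?F m \<Sigma>) (at \<mu>) = J"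
      unfolding jacobian_def frechet_derivative_at[OF J, symmetric] by simp
    moreover have "transpose \<Sigma> = \<Sigma>" using S by (simp add: spd_def)
    ultimately have "jacobian_cov ?F \<mu> \<Sigma> = ?G \<mu> \<Sigma>"
      using matrix_transpose_mul[of J \<Sigma>] by (simp add: jacobian_cov_def pwa_cov_def JS)
    with J show ?thesis by (auto simp: differentiable_def)
  qed
  \<comment> \<open>A Jacobian depends on the function near the point, so equality at all means is
    required; it holds because positive definiteness constrains only the covariance.\<close>
  have meanS: "(\<lambda>m. mean_rhs f m \<Sigma>) = (\<lambda>m. ?F m \<Sigma>)" if "spd \<Sigma>" for \<Sigma>
    using mean[OF that] by blast
  have "jacobian_cov (mean_rhs f) \<mu> \<Sigma> = jacobian_cov ?F \<mu> \<Sigma>" if "spd \<Sigma>" for \<mu> \<Sigma>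
    unfolding jacobian_cov_def meanS[OF that] ..
  \<comment> \<open>A solution keeps a positive definite covariance by definition, so the right-hand
    sides agree along every candidate trajectory and the initial value problems have the same
    solutions.\<close>
  then show ?thesis
    using int mean cov jac meanS
    by (auto simp: has_bochner_integral_iff solves_moment_ivp_def)
qed

end
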